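(* For all $a,b\in\{2,3,4\}$ with $a\ne b$, the subgroup $T_{a,b}$ of $\mathrm{Aut}(\mathcal{O}_4)$ is contained in $\lambda^{-1}(\mathcal{P}_4^2)$ and is isomorphic to $S_4$. The kernel of the restriction to $T_{a,b}$ of the canonical projection, $\pi:T_{a,b}\to\mathrm{Out}(\mathcal{O}_4)$, is trivial, and the $6$ groups $\pi(T_{a,b})$ are mutually distinct.
   Context: $[n]=\{1,\dots,n\}$; $S(A)$ is the symmetric group on $A$, $S_n=S([n])$; permutations are in disjoint cycle form, composed right to left. The Cuntz algebra $\mathcal{O}_n$ ($n\ge2$) is the universal $C^*$-algebra generated by isometries $S_1,\dots,S_n$ with $\sum_iS_iS_i^*=1$. For a unitary $u\in\mathcal{O}_n$, $\lambda_u$ is the unique unital $*$-endomorphism of $\mathcal{O}_n$ with $\lambda_u(S_i)=uS_i$ for all $i$. A permutation $u\in S([n]^t)$ is identified with the unitary $\sum_{\alpha\in[n]^t}S_{u(\alpha)}S_\alpha^*$, where $S_\alpha=S_{\alpha_1}\cdots S_{\alpha_t}$; $\mathcal{P}_n^t$ is the set of these unitaries, and $\lambda_u$ for a permutation $u$ means $\lambda$ of the corresponding unitary. $\lambda^{-1}(\mathcal{P}_n^2):=\{\lambda_u\in\mathrm{Aut}(\mathcal{O}_n): u\in\mathcal{P}_n^2\}$. $\mathrm{Out}(\mathcal{O}_n)$ is the quotient of $\mathrm{Aut}(\mathcal{O}_n)$ by inner automorphisms and $\pi$ is the canonical projection. For $a\ne b$ in $\{2,3,4\}$ let $\{c\}=\{2,3,4\}\setminus\{a,b\}$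 and define in $S([4]^2)$ $$s_1=((1,1),(1,b))\,((b,1),(b,b))\,((1,a),(1,c))\,((b,a),(b,c)),$$ $$s_2=((1,b),(a,b))\,((b,b),(c,b))\,((1,c),(a,c))\,((b,c),(c,c)),$$ $$s_3=((a,1),(a,b))\,((c,1),(c,b))\,((a,a),(a,c))\,((c,a),(c,c)).$$ $T_{a,b}$ is the subgroup of $\mathrm{Aut}(\mathcal{O}_4)$ generated by $\lambda_{s_1},\lambda_{s_2},\lambda_{s_3}$. *)

theory Defs
  imports "HOL-Analysis.Analysis" "HOL-Algebra.Algebra" "HOL-Algebra.Algebraic_Closure_Type"
begin

section \<open>Unital C*-algebras\<close>

abbreviation complex_ring :: "complex ring" where
  "complex_ring \<equiv> ring_of_type_algebra"

record 'a cstar_struct = "(complex, 'a) module" +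
  star :: "'a \<Rightarrow> 'a"
  nrm :: "'a \<Rightarrow> real"

text \<open>The distance is cut off outside the carrier because the locale \<^locale>\<open>Metric_space\<close>
  demands symmetry and nonnegativity on the whole type.\<close>

definition cstar_dist :: "'a cstar_struct \<Rightarrow> 'a \<Rightarrow> 'a \<Rightarrow> real" where
  "cstar_dist A x y =
     (if x \<in> carrier A \<and> y \<in> carrier A then nrm A (x \<ominus>\<^bsub>A\<^esub> y) else 0)"

text \<open>The zero algebra is not excluded here.\<close>

locale cstar_algebra = module complex_ring A + ring A for A :: "'a cstar_struct" (structure) +
  assumes smult_mult_left:
      "\<lbrakk>x \<in> carrier A; y \<in> carrier A\<rbrakk> \<Longrightarrow> (c \<odot> x) \<otimes> y = c \<odot> (x \<otimes> y)"
    and smult_mult_right: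
      "\<lbrakk>x \<in> carrier A; y \<in> carrier A\<rbrakk> \<Longrightarrow> x \<otimes> (c \<odot> y) = c \<odot> (x \<otimes> y)"
    and star_closed: "x \<in> carrier A \<Longrightarrow> star A x \<in> carrier A"
    and star_star: "x \<in> carrier A \<Longrightarrow> star A (star A x) = x"
    and star_add: "\<lbrakk>x \<in> carrier A; y \<in> carrier A\<rbrakk> \<Longrightarrow> star A (x \<oplus> y) = star A x \<oplus> star A y"
    and star_smult: "x \<in> carrier A \<Longrightarrow> star A (c \<odot> x) = cnj c \<odot> star A x"
    and star_mult: "\<lbrakk>x \<in> carrier A; y \<in> carrier A\<rbrakk> \<Longrightarrow> star A (x \<otimes> y) = star A y \<otimes> star A x"
    and nrm_nonneg: "x \<in> carrier A \<Longrightarrow> 0 \<le> nrm A x"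
    and nrm_eq_0_iff: "x \<in> carrier A \<Longrightarrow> nrm A x = 0 \<longleftrightarrow> x = \<zero>"
    and nrm_triangle: "\<lbrakk>x \<in> carrier A; y \<in> carrier A\<rbrakk> \<Longrightarrow> nrm A (x \<oplus> y) \<le> nrm A x + nrm A y"
    and nrm_smult: "x \<in> carrier A \<Longrightarrow> nrm A (c \<odot> x) = cmod c * nrm A x"
    and nrm_mult: "\<lbrakk>x \<in> carrier A; y \<in> carrier A\<rbrakk> \<Longrightarrow> nrm A (x \<otimes> y) \<le> nrm A x * nrm A y"
    and nrm_cstar: "x \<in> carrier A \<Longrightarrow> nrm A (star A x \<otimes> x) = (nrm A x)\<^sup>2"
    and complete: "Metric_space.mcomplete (carrier A) (cstar_dist A)"

lemma (in cstar_algebra) nrm_minus: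
  assumes x: "x \<in> carrier A" shows "nrm A (\<ominus> x) = nrm A x"
proof -
  have "((-1) \<odot> x) \<oplus> x = ((-1) \<odot> x) \<oplus> (1 \<odot> x)"
    using smult_one[OF x] by (simp add: ring_of_type_algebra_def)
  also have "\<dots> = ((-1) + 1) \<odot> x"
    using smult_l_distr[of "-1" 1 x] x by (simp add: ring_of_type_algebra_def)
  also have "\<dots> = \<zero>"
    using smult_l_null[OF x] by (simp add: ring_of_type_algebra_def)
  finally have "(-1) \<odot> x = \<ominus> x"
    using minus_equality[of "(-1) \<odot> x" x] x smult_closed[of "-1" x]
    by (simp add: ring_of_type_algebra_def)
  then show ?thesis
    using nrm_smult[OF x, of "-1"] by simp
qed

lemma (in cstar_algebra) Metric_space_cstar_dist: "Metric_space (carrier A) (cstar_dist A)"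
proof
  fix x y
  show "0 \<le> cstar_dist A x y"
    by (simp add: cstar_dist_def nrm_nonneg)
  have "x \<ominus> y = \<ominus> (y \<ominus> x)" if "x \<in> carrier A" "y \<in> carrier A"
    using that by (simp add: a_minus_def minus_add a_comm)
  then show "cstar_dist A x y = cstar_dist A y x"
    by (simp add: cstar_dist_def nrm_minus)
next
  fix x y assume "x \<in> carrier A" "y \<in> carrier A"
  then show "cstar_dist A x y = 0 \<longleftrightarrow> x = y"
    by (simp add: cstar_dist_def nrm_eq_0_iff)
next
  fix x y z assume xyz: "x \<in> carrier A" "y \<in> carrier A" "z \<in> carrier A"
  then have "x \<ominus> z = (x \<ominus> y) \<oplus> (y \<ominus> z)"
    by (simp add: a_minus_def a_assoc r_neg2 r_neg1)
  with xyz nrm_triangle[of "x \<ominus> y" "y \<ominus> z"]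
  show "cstar_dist A x z \<le> cstar_dist A x y + cstar_dist A y z"
    by (simp add: cstar_dist_def)
qed

text \<open>Unital *-homomorphisms, as extensional functions so that they are determined by their
  values on the carrier (cf. \<^const>\<open>Bij\<close>); \<^const>\<open>ring_hom\<close> includes preservation
  of the unit.\<close>

definition cstar_hom :: "'a cstar_struct \<Rightarrow> 'b cstar_struct \<Rightarrow> ('a \<Rightarrow> 'b) set" where
  "cstar_hom A B = {f \<in> ring_hom A B. f \<in> extensional (carrier A) \<and>
     (\<forall>c. \<forall>x\<in>carrier A. f (c \<odot>\<^bsub>A\<^esub> x) = c \<odot>\<^bsub>B\<^esub> f x) \<and>
     (\<forall>x\<in>carrier A. f (star A x) = star B (f x))}"

definition cstar_subalgebra :: "'a set \<Rightarrow> 'a cstar_struct \<Rightarrow> bool" where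
  "cstar_subalgebra H A \<longleftrightarrow> subring H A \<and>
     (\<forall>c. \<forall>x\<in>H. c \<odot>\<^bsub>A\<^esub> x \<in> H) \<and> (\<forall>x\<in>H. star A x \<in> H) \<and>
     closedin (Metric_space.mtopology (carrier A) (cstar_dist A)) H"

definition cstar_generated_by :: "'a cstar_struct \<Rightarrow> 'a set \<Rightarrow> bool" where
  "cstar_generated_by A G \<longleftrightarrow> (\<forall>H. cstar_subalgebra H A \<and> G \<subseteq> H \<longrightarrow> H = carrier A)"

definition unitaries :: "'a cstar_struct \<Rightarrow> 'a set" where
  "unitaries A =
     {w \<in> carrier A. star A w \<otimes>\<^bsub>A\<^esub> w = \<one>\<^bsub>A\<^esub> \<and> w \<otimes>\<^bsub>A\<^esub> star A w = \<one>\<^bsub>A\<^esub>}"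

section \<open>Automorphisms, inner automorphisms and outer automorphisms\<close>

definition Aut :: "'a cstar_struct \<Rightarrow> ('a \<Rightarrow> 'a) monoid" where
  "Aut A = (BijGroup (carrier A))\<lparr>carrier := cstar_hom A A \<inter> Bij (carrier A)\<rparr>"

definition Inn :: "'a cstar_struct \<Rightarrow> ('a \<Rightarrow> 'a) set" where
  "Inn A = {\<lambda>x\<in>carrier A. w \<otimes>\<^bsub>A\<^esub> x \<otimes>\<^bsub>A\<^esub> star A w | w. w \<in> unitaries A}"

definition Out :: "'a cstar_struct \<Rightarrow> ('a \<Rightarrow> 'a) set monoid" where
  "Out A = Aut A Mod Inn A"

definition out_proj :: "'a cstar_struct \<Rightarrow> ('a \<Rightarrow> 'a) \<Rightarrow> ('a \<Rightarrow> 'a) set" where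
  "out_proj A f = Inn A #>\<^bsub>Aut A\<^esub> f"

section \<open>The Cuntz algebra\<close>

text \<open>The generators are indexed by \<open>{1..n}\<close>.\<close>

definition cuntz_family :: "'a cstar_struct \<Rightarrow> nat \<Rightarrow> (nat \<Rightarrow> 'a) \<Rightarrow> bool" where
  "cuntz_family B n T \<longleftrightarrow>
     (\<forall>i\<in>{1..n}. T i \<in> carrier B \<and> star B (T i) \<otimes>\<^bsub>B\<^esub> T i = \<one>\<^bsub>B\<^esub>) \<and>
     (\<Oplus>\<^bsub>B\<^esub>i\<in>{1..n}. T i \<otimes>\<^bsub>B\<^esub> star B (T i)) = \<one>\<^bsub>B\<^esub>"

text \<open>\<open>A\<close>, with generators \<open>S\<close>, is the universal C*-algebra on a Cuntz family.

  HOL cannot quantify over types inside a formula, so the universal property is stated for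
  targets \<open>B\<close> whose carrier lies in the type \<open>'a\<close>. This is no loss: \<open>A\<close> is nonzero, so \<open>'a\<close>
  has at least the cardinality of the continuum, and the image of a homomorphism from \<open>A\<close>
  lies in the C*-subalgebra generated by \<open>T\<close>, which is separable and hence has a copy inside
  \<open>'a\<close>. Nonzeroness, which follows from universality over all C*-algebras, has to be
  required explicitly, as on a type too small to carry a nonzero C*-algebra the zero algebra
  would have the property.\<close>

locale cuntz_algebra = cstar_algebra A for A :: "'a cstar_struct" (structure) +
  fixes n :: nat and S :: "nat \<Rightarrow> 'a"
  assumes n_ge_2: "2 \<le> n"
    and nonzero: "\<one> \<noteq> \<zero>"
    and family: "cuntz_family A n S"
    and generated: "cstar_generated_by A (S ` {1..n})"
    and universal: "\<And>(B :: 'a cstar_struct) T. \<lbrakk>cstar_algebra B; cuntz_family B n T\<rbrakk> \<Longrightarrow>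
        \<exists>!f. f \<in> cstar_hom A B \<and> (\<forall>i\<in>{1..n}. f (S i) = T i)"

definition lam :: "'a cstar_struct \<Rightarrow> nat \<Rightarrow> (nat \<Rightarrow> 'a) \<Rightarrow> 'a \<Rightarrow> 'a \<Rightarrow> 'a" where
  "lam A n S u = (THE f. f \<in> cstar_hom A A \<and> (\<forall>i\<in>{1..n}. f (S i) = u \<otimes>\<^bsub>A\<^esub> S i))"

lemma (in cuntz_algebra) lam_well_defined:
  assumes u: "u \<in> unitaries A"
  shows "\<exists>!f. f \<in> cstar_hom A A \<and> (\<forall>i\<in>{1..n}. f (S i) = u \<otimes> S i)"
proof (rule universal)
  show "cstar_algebra A" ..
  have uc: "u \<in> carrier A" "star A u \<in> carrier A" "star A u \<otimes> u = \<one>" "u \<otimes> star A u = \<one>"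
    using u by (auto simp: unitaries_def star_closed)
  have S: "S i \<in> carrier A" "star A (S i) \<in> carrier A" "star A (S i) \<otimes> S i = \<one>"
    if "i \<in> {1..n}" for i
    using family that by (auto simp: cuntz_family_def star_closed)
  have 1: "star A (u \<otimes> S i) \<otimes> (u \<otimes> S i) = \<one>" if "i \<in> {1..n}" for i
  proof -
    have "star A (u \<otimes> S i) \<otimes> (u \<otimes> S i) = star A (S i) \<otimes> ((star A u \<otimes> u) \<otimes> S i)"
      using uc(1,2) S(1,2)[OF that] by (simp add: star_mult m_assoc)
    with uc(3) S[OF that] show ?thesis by simp
  qed
  have "(\<Oplus>i\<in>{1..n}. (u \<otimes> S i) \<otimes> star A (u \<otimes> S i)) =
        (\<Oplus>i\<in>{1..n}. u \<otimes> ((S i \<otimes> star A (S i)) \<otimes> star A u))"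
    using uc S by (intro finsum_cong') (auto simp: star_mult m_assoc)
  also have "\<dots> = u \<otimes> ((\<Oplus>i\<in>{1..n}. S i \<otimes> star A (S i)) \<otimes> star A u)"
    using uc S by (subst finsum_ldistr, simp, simp, force, subst finsum_rdistr) auto
  also have "\<dots> = \<one>"
    using family uc by (simp add: cuntz_family_def)
  finally show "cuntz_family A n (\<lambda>i. u \<otimes> S i)"
    using 1 uc S by (auto simp: cuntz_family_def)
qed

section \<open>Permutation unitaries\<close>

definition words :: "nat \<Rightarrow> nat \<Rightarrow> nat list set" where
  "words n t = {\<alpha>. length \<alpha> = t \<and> set \<alpha> \<subseteq> {1..n}}"

definition S_word :: "'a cstar_struct \<Rightarrow> (nat \<Rightarrow> 'a) \<Rightarrow> nat list \<Rightarrow> 'a" where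
  "S_word A S \<alpha> = foldr (\<lambda>i x. S i \<otimes>\<^bsub>A\<^esub> x) \<alpha> \<one>\<^bsub>A\<^esub>"

definition perm_unitary ::
    "'a cstar_struct \<Rightarrow> nat \<Rightarrow> (nat \<Rightarrow> 'a) \<Rightarrow> nat \<Rightarrow> (nat list \<Rightarrow> nat list) \<Rightarrow> 'a" where
  "perm_unitary A n S t u =
     (\<Oplus>\<^bsub>A\<^esub>\<alpha>\<in>words n t. S_word A S (u \<alpha>) \<otimes>\<^bsub>A\<^esub> star A (S_word A S \<alpha>))"

definition perm_unitaries :: "'a cstar_struct \<Rightarrow> nat \<Rightarrow> (nat \<Rightarrow> 'a) \<Rightarrow> nat \<Rightarrow> 'a set" where
  "perm_unitaries A n S t = perm_unitary A n S t ` {u. u permutes words n t}"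

text \<open>\<open>lam_inv A n S t\<close> is $\lambda^{-1}(\mathcal{P}_n^t)$, a set of automorphisms.\<close>

definition lam_inv :: "'a cstar_struct \<Rightarrow> nat \<Rightarrow> (nat \<Rightarrow> 'a) \<Rightarrow> nat \<Rightarrow> ('a \<Rightarrow> 'a) set" where
  "lam_inv A n S t = {lam A n S u | u. u \<in> perm_unitaries A n S t} \<inter> carrier (Aut A)"

section \<open>The subgroups generated by three permutation automorphisms\<close>

definition third :: "nat \<Rightarrow> nat \<Rightarrow> nat" where
  "third a b = the_elem ({2,3,4} - {a, b})"

text \<open>\<open>sw i j k l\<close> is the 2-cycle \<open>((i,j),(k,l))\<close>.\<close>

definition sw :: "nat \<Rightarrow> nat \<Rightarrow> nat \<Rightarrow> nat \<Rightarrow> nat list \<Rightarrow> nat list" where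
  "sw i j k l = Transposition.transpose [i, j] [k, l]"

definition s1 :: "nat \<Rightarrow> nat \<Rightarrow> nat list \<Rightarrow> nat list" where
  "s1 a b = (let c = third a b in sw 1 1 1 b \<circ> sw b 1 b b \<circ> sw 1 a 1 c \<circ> sw b a b c)"

definition s2 :: "nat \<Rightarrow> nat \<Rightarrow> nat list \<Rightarrow> nat list" where
  "s2 a b = (let c = third a b in sw 1 b a b \<circ> sw b b c b \<circ> sw 1 c a c \<circ> sw b c c c)"

definition s3 :: "nat \<Rightarrow> nat \<Rightarrow> nat list \<Rightarrow> nat list" where
  "s3 a b = (let c = third a b in sw a 1 a b \<circ> sw c 1 c b \<circ> sw a a a c \<circ> sw c a c c)"

definition T_group :: "'a cstar_struct \<Rightarrow> (nat \<Rightarrow> 'a) \<Rightarrow> nat \<Rightarrow> nat \<Rightarrow> ('a \<Rightarrow> 'a) set" where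
  "T_group A S a b = generate (Aut A)
     ((\<lambda>s. lam A 4 S (perm_unitary A 4 S 2 s)) ` {s1 a b, s2 a b, s3 a b})"

end

theory Submission
  imports Defs
begin

text \<open>View the letters as the points $1 = (0,0)$, $a = (1,0)$, $b = (0,1)$, $c = (1,1)$ of a grid and
  put $i * j = (x_i, y_j)$. This is a rectangular band: $i * i = i$ and $i * j * k = i * k$. A
  permutation \<open>\<theta>\<close> of the letters acts on pairs by
  $[i, j] \mapsto [\theta(i * j) * i, j * \theta(i * j)]$, and $s_1, s_2, s_3$ are the pair
  permutations of the transpositions $(1\,b)$, $(b\,c)$, $(a\,c)$, which generate $S_4$. The pair
  permutations at overlapping positions change different coordinates, so
  $\theta \mapsto \lambda_\theta$ is a homomorphism from $S_4$.

  Suppose $w$ is a unitary with $V_i w = w V'_i$, where $V_i$ and $V'_i$ are the images of $S_i$ under two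
  such automorphisms. Then $w = V_\alpha^* w V'_\alpha$ for all words $\alpha$. On words, $V_\alpha$ and
  $V'_\alpha$ act as sliding block codes; if along the prefixes $\alpha$ of some sequence the two coded
  sequences have no common tail, then $V_\alpha^* S_\mu S_\nu^* V'_\alpha = 0$ for long $\alpha$. Since the
  $S_\mu S_\nu^*$ span a dense subspace, $w = 0$, a contradiction. Constant sequences show
  that the two automorphisms belong to the same $\theta$, and sequences of period 3 show that the
  two grids agree.\<close>

section \<open>Norm estimates and orthogonality of the isometries\<close>

text \<open>\<open>cuntz_family\<close> only says that the generators are isometries whose range
  projections sum to 1. That distinct generators have orthogonal ranges, on which all computation
  with words rests, is usually read off from positivity; with neither order nor spectral theory set
  up, it is derived here from the norm axioms alone.

  The group law comes from lambda_u lambda_v = lambda_w with w = lambda_u(v) u, which is tested on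
  words of length 2. Bijectivity then follows from the group law, applied to the inverse
  permutation.

  Injectivity on permutations, triviality of the kernel and distinctness of the six images are three
  instances of one comparison, of two grids and two permutations whose automorphisms agree up to an
  inner one. Equality of two images gives for each \<theta> only some \<tau>, so \<theta> = \<tau>
  has to be settled before the grids are compared. A term S_mu S_nu^* shifts the two codes against
  each other by arbitrary amounts, so only shift-invariant data can be used: for a periodic
  sequence, the set of letters that occur.\<close>

declare ring_of_type_algebra_def [simp]

context cstar_algebra
begin

lemma smult_in_carrier [simp]: "x \<in> carrier A \<Longrightarrow> c \<odot> x \<in> carrier A"
  using smult_closed[of c x] by simp

lemma smult_add_left: "x \<in> carrier A \<Longrightarrow> (c + d) \<odot> x = c \<odot> x \<oplus> d \<odot> x"
  using smult_l_distr[of c d x] by simp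

lemma smult_add_right:
  "\<lbrakk>x \<in> carrier A; y \<in> carrier A\<rbrakk> \<Longrightarrow> c \<odot> (x \<oplus> y) = c \<odot> x \<oplus> c \<odot> y"
  using smult_r_distr[of c x y] by simp

lemma smult_smult [simp]: "x \<in> carrier A \<Longrightarrow> c \<odot> (d \<odot> x) = (c * d) \<odot> x"
  using smult_assoc1[of c d x] by simp

lemma smult_one_left [simp]: "x \<in> carrier A \<Longrightarrow> 1 \<odot> x = x"
  using smult_one[of x] by simp

lemma smult_zero_left [simp]: "x \<in> carrier A \<Longrightarrow> 0 \<odot> x = \<zero>"
  using smult_l_null[of x] by simp

lemma smult_zero_right [simp]: "c \<odot> \<zero> = \<zero>"
  using smult_r_null[of c] by simp

lemma a_inv_eq_smult: "x \<in> carrier A \<Longrightarrow> \<ominus> x = (-1) \<odot> x"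
  using minus_equality[of "(-1) \<odot> x" x] smult_add_left[of x "-1" 1] by simp

declare star_closed [simp] star_star [simp] smult_mult_left [simp] smult_mult_right [simp]

lemma star_one [simp]: "star A \<one> = \<one>"
proof -
  have "star A \<one> = star A (star A (star A \<one> \<otimes> \<one>))"
    by simp
  also have "\<dots> = star A \<one> \<otimes> \<one>"
    using star_mult[of "star A \<one>" \<one>] by simp
  also have "star A (star A \<one> \<otimes> \<one>) = \<one>"
    by simp
  finally show ?thesis
    using star_mult[of "star A \<one>" \<one>] by simp
qed

lemma star_zero [simp]: "star A \<zero> = \<zero>"
  using star_smult[of \<zero> 0] by simp

lemma nrm_zero [simp]: "nrm A \<zero> = 0"
  by (simp add: nrm_eq_0_iff)

lemma nrm_one_le: "nrm A \<one> \<le> 1"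
proof -
  have "nrm A \<one> = (nrm A \<one>)\<^sup>2"
    using nrm_cstar[of \<one>] by simp
  then have "nrm A \<one> = 0 \<or> nrm A \<one> = 1"
    by (auto simp: power2_eq_square)
  then show ?thesis
    by auto
qed

lemma nrm_star_le: "x \<in> carrier A \<Longrightarrow> nrm A x \<le> nrm A (star A x)"
  using nrm_cstar[of x] nrm_mult[of "star A x" x] nrm_nonneg[of x] nrm_nonneg[of "star A x"]
  by (cases "nrm A x = 0") (auto simp: power2_eq_square)

lemma nrm_star [simp]: "x \<in> carrier A \<Longrightarrow> nrm A (star A x) = nrm A x"
  using nrm_star_le[of x] nrm_star_le[of "star A x"] by simp

lemma nrm_isometry_le:
  assumes "x \<in> carrier A" "star A x \<otimes> x = \<one>"
  shows "nrm A x \<le> 1"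
proof -
  have "(nrm A x)\<^sup>2 \<le> 1\<^sup>2"
    using nrm_cstar[of x] assms nrm_one_le by simp
  then show ?thesis
    by (rule power2_le_imp_le) simp
qed

lemma nrm_mult_le_one:
  assumes "x \<in> carrier A" "y \<in> carrier A" "nrm A x \<le> 1" "nrm A y \<le> 1"
  shows "nrm A (x \<otimes> y) \<le> 1"
  using nrm_mult[of x y] assms nrm_nonneg[of x] nrm_nonneg[of y]
    mult_mono[of "nrm A x" 1 "nrm A y" 1] by simp

lemma nrm_finsum_le:
  assumes "finite I" "f \<in> I \<rightarrow> carrier A"
  shows "nrm A (\<Oplus>i\<in>I. f i) \<le> (\<Sum>i\<in>I. nrm A (f i))"
  using assms
proof (induction I rule: finite_induct)
  case (insert i I)
  then have "nrm A (\<Oplus>i\<in>insert i I. f i) = nrm A (f i \<oplus> (\<Oplus>i\<in>I. f i))"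
    by (subst finsum_insert) auto
  also have "\<dots> \<le> nrm A (f i) + nrm A (\<Oplus>i\<in>I. f i)"
    using insert by (intro nrm_triangle finsum_closed) auto
  also have "\<dots> \<le> nrm A (f i) + (\<Sum>i\<in>I. nrm A (f i))"
    using insert by auto
  finally show ?case
    using insert by simp
qed simp

lemma smult_finsum:
  assumes "finite I" "f \<in> I \<rightarrow> carrier A"
  shows "c \<odot> (\<Oplus>i\<in>I. f i) = (\<Oplus>i\<in>I. c \<odot> f i)"
  using assms
proof (induction I rule: finite_induct)
  case (insert i I)
  then show ?case
    by (simp add: smult_add_right Pi_iff finsum_closed)
qed simp

lemma finsum_const_smult:
  assumes "finite I" "x \<in> carrier A"
  shows "(\<Oplus>i\<in>I. x) = of_nat (card I) \<odot> x"
  using assms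
proof (induction I rule: finite_induct)
  case (insert i I)
  then show ?case
    using smult_add_left[of x 1 "of_nat (card I)"] by (simp add: Pi_iff)
qed simp

lemma star_finsum:
  assumes "finite I" "f \<in> I \<rightarrow> carrier A"
  shows "star A (\<Oplus>i\<in>I. f i) = (\<Oplus>i\<in>I. star A (f i))"
  using assms
proof (induction I rule: finite_induct)
  case (insert i I)
  then show ?case
    by (simp add: star_add Pi_iff finsum_closed)
qed simp

text \<open>Moves identities between powers of one element into \<open>complex poly\<close>, where
  simp verifies them by multiplying out; the norm estimates below then only have to name
  polynomials.\<close>

definition poly_eval :: "'a \<Rightarrow> complex poly \<Rightarrow> 'a" where
  "poly_eval h p = fold_coeffs (\<lambda>a x. a \<odot> \<one> \<oplus> h \<otimes> x) p \<zero>"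

lemma poly_eval_0 [simp]: "poly_eval h 0 = \<zero>"
  by (simp add: poly_eval_def)

lemma poly_eval_pCons [simp]:
  assumes "h \<in> carrier A"
  shows "poly_eval h (pCons a p) = a \<odot> \<one> \<oplus> h \<otimes> poly_eval h p"
  using assms by (cases "a = 0"; cases "p = 0") (auto simp: poly_eval_def)

lemma poly_eval_closed [simp]: "h \<in> carrier A \<Longrightarrow> poly_eval h p \<in> carrier A"
  by (induction p) auto

lemma poly_eval_add:
  "h \<in> carrier A \<Longrightarrow> poly_eval h (p + q) = poly_eval h p \<oplus> poly_eval h q"
proof (induction p q rule: poly_induct2)
  case (pCons a p b q)
  then show ?case
    by (simp add: smult_add_left r_distr a_ac)
qed simp

lemma poly_eval_smult: "h \<in> carrier A \<Longrightarrow> poly_eval h (Polynomial.smult c p) = c \<odot> poly_eval h p"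
  by (induction p) (auto simp: smult_add_right)

lemma poly_eval_mult:
  "h \<in> carrier A \<Longrightarrow> poly_eval h (p * q) = poly_eval h p \<otimes> poly_eval h q"
proof (induction p)
  case (pCons a p)
  then show ?case
    by (simp add: poly_eval_add poly_eval_smult l_distr m_assoc)
qed simp

text \<open>The scaled element is reached by the convex combination
  $1 + \frac32 h = \frac34 (1+h)^2 + \frac1{16} (1+ih)^4 + \frac1{16} (1-ih)^4
    + \frac18 (1+h)(1-h)(1+h^2)$
  of contractions, where $\|1 \pm ih\|^2 = \|1+h^2\|$ and $1+h^2$ is the mean of $(1 \pm h)^2$.\<close>

lemma contraction_unit_perturb_scale:
  assumes h: "h \<in> carrier A" "star A h = h"
    and bd: "nrm A (\<one> \<oplus> h) \<le> 1" "nrm A (\<one> \<oplus> (-1) \<odot> h) \<le> 1"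
  shows "nrm A (\<one> \<oplus> (3/2) \<odot> h) \<le> 1"
proof -
  define N where "N p = nrm A (poly_eval h p)" for p
  have N_lin: "N [:1, c:] = nrm A (\<one> \<oplus> c \<odot> h)" for c
    using h by (simp add: N_def)
  have N_mult: "N (p * q) \<le> 1" if "N p \<le> 1" "N q \<le> 1" for p q
    using that h by (auto simp: N_def poly_eval_mult intro: nrm_mult_le_one)
  have N_add: "N (p + q) \<le> N p + N q" for p q
    using h by (auto simp: N_def poly_eval_add intro: nrm_triangle)
  have N_smult: "N (Polynomial.smult c p) = cmod c * N p" for c p
    using h by (simp add: N_def poly_eval_smult nrm_smult)
  have N1: "N [:1, 1:] \<le> 1" "N [:1, -1:] \<le> 1"
    using bd h by (simp_all add: N_lin)
  have sq: "N [:1, 0, 1:] \<le> 1"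
  proof -
    have "[:1, 0, 1:] = Polynomial.smult (1/2) ([:1, 1:] * [:1, 1:]) + Polynomial.smult (1/2) ([:1, -1:] * [:1, -1::complex:])"
      by simp
    then have "N [:1, 0, 1:] \<le> N (Polynomial.smult (1/2) ([:1, 1:] * [:1, 1:]))
        + N (Polynomial.smult (1/2) ([:1, -1:] * [:1, -1:]))"
      using N_add by metis
    also have "\<dots> \<le> 1/2 * 1 + 1/2 * 1"
      unfolding N_smult using N_mult[OF N1(1) N1(1)] N_mult[OF N1(2) N1(2)] by simp
    finally show ?thesis by simp
  qed
  have N_im: "N [:1, c:] \<le> 1" if "c = \<i> \<or> c = -\<i>" for c
  proof -
    have "star A (poly_eval h [:1, c:]) = poly_eval h [:1, - c:]"
      using h that by (auto simp: star_add star_smult)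
    then have "(N [:1, c:])\<^sup>2 = N ([:1, -c:] * [:1, c:])"
      using nrm_cstar[of "poly_eval h [:1, c:]"] h(1)
      unfolding N_def poly_eval_mult[OF h(1)] by simp
    also have "[:1, -c:] * [:1, c:] = [:1, 0, 1:]"
      using that by auto
    finally have "(N [:1, c:])\<^sup>2 \<le> 1\<^sup>2"
      using sq by simp
    then show ?thesis
      by (rule power2_le_imp_le) simp
  qed
  have four: "N (p * p * (p * p)) \<le> 1" if "N p \<le> 1" for p
    using that by (intro N_mult)
  let ?a = "[:1, 1:] * [:1, 1:] :: complex poly"
  let ?b = "[:1, \<i>:] * [:1, \<i>:] * ([:1, \<i>:] * [:1, \<i>:])"
  let ?c = "[:1, -\<i>:] * [:1, -\<i>:] * ([:1, -\<i>:] * [:1, -\<i>:])"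
  let ?d = "[:1, 1:] * [:1, -1:] * [:1, 0, 1:] :: complex poly"
  have "[:1, 3/2:] = Polynomial.smult (3/4) ?a + (Polynomial.smult (1/16) ?b + (Polynomial.smult (1/16) ?c + Polynomial.smult (1/8) ?d))"
    by simp
  then have "N [:1, 3/2:] \<le> N (Polynomial.smult (3/4) ?a) + (N (Polynomial.smult (1/16) ?b)
      + (N (Polynomial.smult (1/16) ?c) + N (Polynomial.smult (1/8) ?d)))"
    by (smt (verit) N_add)
  also have "\<dots> \<le> 3/4 * 1 + (1/16 * 1 + (1/16 * 1 + 1/8 * 1))"
    unfolding N_smult
    using N_mult[OF N1(1) N1(1)] four[OF N_im[of \<i>]] four[OF N_im[of "-\<i>"]]
      N_mult[OF N_mult[OF N1] sq]
    by (intro add_mono mult_mono) (auto simp: N_def nrm_nonneg h)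
  finally show ?thesis
    using N_lin by simp
qed

text \<open>The unit is an extreme point of the unit ball, here in self-adjoint directions. By
  iterated scaling, 1 + c h and 1 - c h stay contractions for c = (3/2)^m; half their difference is
  c h, so (3/2)^m times the norm of h is at most 1 for every m.\<close>

lemma contraction_unit_perturb_eq_zero:
  assumes h: "h \<in> carrier A" "star A h = h"
    and bd: "nrm A (\<one> \<oplus> h) \<le> 1" "nrm A (\<one> \<oplus> (-1) \<odot> h) \<le> 1"
  shows "h = \<zero>"
proof -
  have P: "nrm A (\<one> \<oplus> c \<odot> h) \<le> 1 \<and> nrm A (\<one> \<oplus> (-c) \<odot> h) \<le> 1" if "c = (3/2) ^ m" for m c
    using that
  proof (induction m arbitrary: c)
    case 0
    then show ?case using bd h by simp
  next
    case (Suc m)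
    let ?d = "(3/2) ^ m :: complex"
    have cd: "cnj ?d = ?d" "c = 3/2 * ?d"
      using Suc.prems by simp_all
    have "nrm A (\<one> \<oplus> (3/2) \<odot> (?d \<odot> h)) \<le> 1"
      by (rule contraction_unit_perturb_scale) (use h Suc.IH[of ?d] in \<open>auto simp: star_smult\<close>)
    moreover have "nrm A (\<one> \<oplus> (3/2) \<odot> ((-?d) \<odot> h)) \<le> 1"
      by (rule contraction_unit_perturb_scale) (use h Suc.IH[of ?d] in \<open>auto simp: star_smult\<close>)
    ultimately show ?case
      using h unfolding cd(2) by simp
  qed
  have bound: "(3/2) ^ m * nrm A h \<le> 1" for m
  proof -
    let ?c = "(3/2) ^ m :: complex"
    have *: "(1/2) \<odot> (\<one> \<oplus> ?c \<odot> h) \<oplus> (-1/2) \<odot> (\<one> \<oplus> (-?c) \<odot> h)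
        = ((1/2) \<odot> \<one> \<oplus> (-1/2) \<odot> \<one>) \<oplus> ((1/2 * ?c) \<odot> h \<oplus> (1/2 * ?c) \<odot> h)"
      using h by (simp add: smult_add_right a_ac)
    also have "\<dots> = ?c \<odot> h"
      using h smult_add_left[of h "1/2 * ?c" "1/2 * ?c"] smult_add_left[of \<one> "1/2" "-1/2"] by simp
    finally have "nrm A (?c \<odot> h) \<le> nrm A ((1/2) \<odot> (\<one> \<oplus> ?c \<odot> h)) + nrm A ((-1/2) \<odot> (\<one> \<oplus> (-?c) \<odot> h))"
      using nrm_triangle[of "(1/2) \<odot> (\<one> \<oplus> ?c \<odot> h)" "(-1/2) \<odot> (\<one> \<oplus> (-?c) \<odot> h)"] h by simp
    also have "\<dots> \<le> 1"
      using P[of ?c m] h by (simp add: nrm_smult)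
    finally show ?thesis
      using h by (simp add: nrm_smult norm_power norm_divide)
  qed
  have "nrm A h = 0"
  proof (rule ccontr)
    assume "nrm A h \<noteq> 0"
    then have pos: "nrm A h > 0"
      using nrm_nonneg[OF h(1)] by simp
    obtain m where "1 / nrm A h < (3/2) ^ m"
      using real_arch_pow[of "3/2" "1 / nrm A h"] by auto
    then show False
      using pos bound[of m] by (simp add: field_simps)
  qed
  then show ?thesis
    using h by (simp add: nrm_eq_0_iff)
qed

text \<open>To avoid the order on a C*-algebra: every $h_k = (T_i^* T_k)(T_i^* T_k)^*$ makes
  $1 - 2 h_k$ a contraction, and $\sum_{k \ne i} h_k = 0$ writes $1 + \frac2n h_j$ as a mean of
  such contractions.\<close>

lemma cuntz_family_orthogonal:
  assumes fam: "cuntz_family A n T" and ij: "i \<in> {1..n}" "j \<in> {1..n}" "i \<noteq> j"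
  shows "star A (T i) \<otimes> T j = \<zero>"
proof -
  have T [simp]: "T k \<in> carrier A" "star A (T k) \<otimes> T k = \<one>" if "k \<in> {1..n}" for k
    using fam that by (auto simp: cuntz_family_def)
  note Ti = T[OF ij(1)]
  define p where "p k = T k \<otimes> star A (T k)" for k
  define h where "h k = star A (T i) \<otimes> p k \<otimes> T i" for k
  define c where "c k = \<one> \<oplus> (-2) \<odot> h k" for k
  have p: "p k \<in> carrier A" "star A (p k) = p k" "p k \<otimes> p k = p k" if "k \<in> {1..n}" for k
  proof -
    show "p k \<in> carrier A" "star A (p k) = p k"
      using that by (auto simp: p_def star_mult)
    have "p k \<otimes> p k = T k \<otimes> ((star A (T k) \<otimes> T k) \<otimes> star A (T k))"
      using that by (simp add: p_def m_assoc del: T(2))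
    then show "p k \<otimes> p k = p k"
      using that by (simp add: p_def)
  qed
  have h: "h k \<in> carrier A" if "k \<in> {1..n}" for k
    using that p Ti by (simp add: h_def)
  have h_sq: "h k = (star A (T i) \<otimes> T k) \<otimes> star A (star A (T i) \<otimes> T k)" if "k \<in> {1..n}" for k
    using that Ti by (simp add: h_def p_def star_mult m_assoc)
  have c: "c k \<in> carrier A" "nrm A (c k) \<le> 1" if k: "k \<in> {1..n}" for k
  proof -
    note pk = p[OF k]
    \<comment> \<open>1 - 2 p is a self-adjoint unitary for every projection p; \<open>c k\<close>
      is its compression by the isometry \<open>T i\<close>, hence a contraction.\<close>
    let ?u = "\<one> \<oplus> (-2) \<odot> p k"
    show "c k \<in> carrier A"
      using k h by (simp add: c_def)
    have "star A ?u \<otimes> ?u = \<one> \<oplus> ((-2) \<odot> p k \<oplus> ((-2) \<odot> p k \<oplus> 4 \<odot> p k))"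
      using pk by (simp add: star_add star_smult l_distr r_distr smult_add_right a_assoc)
    also have "(-2) \<odot> p k \<oplus> ((-2) \<odot> p k \<oplus> 4 \<odot> p k) = (-2 + (-2 + 4)) \<odot> p k"
      using pk(1) by (simp only: smult_add_left smult_in_carrier)
    also have "\<dots> = \<zero>"
      using pk by simp
    finally have "nrm A ?u \<le> 1"
      using pk by (intro nrm_isometry_le) auto
    moreover have "c k = star A (T i) \<otimes> ?u \<otimes> T i"
      using pk Ti by (simp add: c_def h_def r_distr l_distr)
    moreover have "nrm A (T i) \<le> 1"
      using Ti by (intro nrm_isometry_le)
    ultimately show "nrm A (c k) \<le> 1"
      using pk Ti by (auto intro!: nrm_mult_le_one)
  qed
  have hi: "h i = \<one>"
    using Ti h_sq[OF ij(1)] by simp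
  have "(\<Oplus>k\<in>{1..n}. h k) = star A (T i) \<otimes> (\<Oplus>k\<in>{1..n}. p k) \<otimes> T i"
    unfolding h_def using Ti p
    by (subst finsum_rdistr, simp, simp, force, subst finsum_ldistr) auto
  also have "\<dots> = \<one>"
    using fam Ti by (simp add: cuntz_family_def p_def)
  finally have sum_h: "(\<Oplus>k\<in>{1..n}. h k) = \<one>" .
  define I where "I = {1..n} - {i, j}"
  have I: "{1..n} = insert i (insert j I)" "finite I" "i \<notin> insert j I" "j \<notin> I"
    using ij by (auto simp: I_def)
  have hI: "h \<in> I \<rightarrow> carrier A" "h i \<in> carrier A" "h j \<in> carrier A"
    using h ij by (auto simp: I_def)
  have sum1: "\<one> \<oplus> (h j \<oplus> (\<Oplus>k\<in>I. h k)) = \<one> \<oplus> \<zero>"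
    using sum_h hI I(2-4) unfolding I(1) by (simp add: hi Pi_iff)
  have sumI: "h j \<oplus> (\<Oplus>k\<in>I. h k) = \<zero>"
    using hI by (intro add.l_cancel[OF sum1]) (auto simp: finsum_closed)
  have card: "card I = n - 2" "n \<ge> 2"
  proof -
    have "card {1..n} = card I + 2"
      unfolding I(1) using I by simp
    then show "card I = n - 2" "n \<ge> 2"
      by auto
  qed
  have sum_c: "(\<Oplus>k\<in>I. c k) = of_nat (n - 2) \<odot> \<one> \<oplus> 2 \<odot> h j"
  proof -
    have "(\<Oplus>k\<in>I. c k) = (\<Oplus>k\<in>I. \<one>) \<oplus> (\<Oplus>k\<in>I. (-2) \<odot> h k)"
      unfolding c_def using hI by (subst finsum_addf) (auto simp: Pi_iff)
    also have "\<dots> = of_nat (n - 2) \<odot> \<one> \<oplus> (-2) \<odot> (\<Oplus>k\<in>I. h k)"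
      using hI I by (simp add: smult_finsum finsum_const_smult card)
    also have "(\<Oplus>k\<in>I. h k) = (-1) \<odot> h j"
      using sumI hI minus_equality[of "\<Oplus>k\<in>I. h k" "h j"]
      by (simp add: finsum_closed a_comm a_inv_eq_smult)
    finally show ?thesis
      using hI by simp
  qed
  have cI: "c \<in> I \<rightarrow> carrier A"
    using c by (auto simp: I_def)
  have n0: "(of_nat n :: complex) \<noteq> 0" "real n > 0"
    using card by auto
  have nc: "nrm A (\<Oplus>k\<in>I. c k) \<le> real n - 2"
  proof -
    have "nrm A (\<Oplus>k\<in>I. c k) \<le> (\<Sum>k\<in>I. nrm A (c k))"
      using cI I by (intro nrm_finsum_le)
    also have "\<dots> \<le> (\<Sum>k\<in>I. 1)"
      using c by (intro sum_mono) (auto simp: I_def)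
    finally show ?thesis
      using card by (simp add: of_nat_diff)
  qed
  \<comment> \<open>The factor 2/n: the n - 2 elements \<open>c k\<close> add up to (n - 2) + 2 h_j,
    so adding two more copies of 1 and dividing by n gives 1 + (2/n) h_j.\<close>
  define g where "g = (2 / of_nat n) \<odot> h j"
  have g: "g \<in> carrier A"
    using hI by (simp add: g_def)
  have "\<one> \<oplus> g = (1 / of_nat n) \<odot> (2 \<odot> \<one> \<oplus> (\<Oplus>k\<in>I. c k))"
  proof -
    have "2 \<odot> \<one> \<oplus> (\<Oplus>k\<in>I. c k) = (2 \<odot> \<one> \<oplus> of_nat (n - 2) \<odot> \<one>) \<oplus> 2 \<odot> h j"
      unfolding sum_c using hI by (simp add: a_assoc)
    also have "2 \<odot> \<one> \<oplus> of_nat (n - 2) \<odot> \<one> = of_nat n \<odot> \<one>"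
      using smult_add_left[of \<one> 2 "of_nat (n - 2)"] card by (simp add: of_nat_diff)
    finally show ?thesis
      using hI n0 by (simp add: smult_add_right g_def)
  qed
  then have "nrm A (\<one> \<oplus> g) = 1 / real n * nrm A (2 \<odot> \<one> \<oplus> (\<Oplus>k\<in>I. c k))"
    using cI by (simp add: nrm_smult norm_divide finsum_closed)
  also have "\<dots> \<le> 1 / real n * (nrm A (2 \<odot> \<one>) + nrm A (\<Oplus>k\<in>I. c k))"
    using cI n0 by (intro mult_left_mono nrm_triangle) (auto simp: finsum_closed)
  also have "\<dots> \<le> 1 / real n * (2 + (real n - 2))"
    using nc nrm_one_le n0 by (intro mult_left_mono add_mono) (auto simp: nrm_smult)
  finally have g1: "nrm A (\<one> \<oplus> g) \<le> 1"
    using n0 by simp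
  have cj: "c j \<in> carrier A" "nrm A (c j) \<le> 1"
    using c ij by auto
  \<comment> \<open>The other sign needs no sum over k: 1 - g is the convex combination of 1 and
    \<open>c j\<close> = 1 - 2 h_j with weights 1 - 1/n and 1/n.\<close>
  have "\<one> \<oplus> (-1) \<odot> g = (1 - 1 / of_nat n) \<odot> \<one> \<oplus> (1 / of_nat n) \<odot> c j"
  proof -
    have "(1 - 1 / of_nat n) \<odot> \<one> \<oplus> (1 / of_nat n) \<odot> c j
        = ((1 - 1 / of_nat n) \<odot> \<one> \<oplus> (1 / of_nat n) \<odot> \<one>) \<oplus> (-1) \<odot> g"
      using hI by (simp add: c_def g_def smult_add_right a_assoc)
    then show ?thesis
      using smult_add_left[of \<one> "1 - 1 / of_nat n" "1 / of_nat n"] by simp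
  qed
  then have "nrm A (\<one> \<oplus> (-1) \<odot> g) \<le> nrm A ((1 - 1 / of_nat n) \<odot> \<one>) + nrm A ((1 / of_nat n) \<odot> c j)"
    using cj by (simp add: nrm_triangle)
  also have "\<dots> = cmod (1 - 1 / of_nat n) * nrm A \<one> + 1 / real n * nrm A (c j)"
    using cj by (simp add: nrm_smult norm_divide)
  also have "cmod (1 - 1 / of_nat n) = 1 - 1 / real n"
  proof -
    have "(1 - 1 / of_nat n :: complex) = of_real (1 - 1 / real n)"
      by simp
    moreover have "\<bar>1 - 1 / real n\<bar> = 1 - 1 / real n"
      using n0 card by (simp add: field_simps)
    ultimately show ?thesis
      by (metis norm_of_real)
  qed
  also have "(1 - 1 / real n) * nrm A \<one> + 1 / real n * nrm A (c j) \<le> (1 - 1 / real n) * 1 + 1 / real n * 1"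
    using nrm_one_le cj n0 card by (intro add_mono mult_left_mono) (auto simp: field_simps)
  finally have g2: "nrm A (\<one> \<oplus> (-1) \<odot> g) \<le> 1"
    by simp
  have "star A (h j) = h j"
    using h_sq[OF ij(2)] Ti T(1)[OF ij(2)] by (simp add: star_mult m_assoc)
  then have "g = \<zero>"
    using g g1 g2 hI by (intro contraction_unit_perturb_eq_zero) (auto simp: g_def star_smult)
  then have "h j = \<zero>"
    using hI n0 smult_smult[of "h j" "of_nat n / 2" "2 / of_nat n"] by (simp add: g_def)
  \<comment> \<open>\<open>h j\<close> is x times its adjoint for x = star (T i) T j, so the
    C*-identity turns h_j = 0 into x = 0.\<close>
  then have "nrm A (star A (T i) \<otimes> T j) = 0"
    using nrm_cstar[of "star A (star A (T i) \<otimes> T j)"] h_sq[OF ij(2)] Ti ij by simp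
  then show ?thesis
    using Ti ij by (simp add: nrm_eq_0_iff)
qed

end

section \<open>Automorphisms, words and permutation unitaries\<close>

lemma cstar_homD:
  assumes "f \<in> cstar_hom A B"
  shows "x \<in> carrier A \<Longrightarrow> f x \<in> carrier B"
    and "\<lbrakk>x \<in> carrier A; y \<in> carrier A\<rbrakk> \<Longrightarrow> f (x \<otimes>\<^bsub>A\<^esub> y) = f x \<otimes>\<^bsub>B\<^esub> f y"
    and "\<lbrakk>x \<in> carrier A; y \<in> carrier A\<rbrakk> \<Longrightarrow> f (x \<oplus>\<^bsub>A\<^esub> y) = f x \<oplus>\<^bsub>B\<^esub> f y"
    and "f \<one>\<^bsub>A\<^esub> = \<one>\<^bsub>B\<^esub>"
    and "x \<in> carrier A \<Longrightarrow> f (c \<odot>\<^bsub>A\<^esub> x) = c \<odot>\<^bsub>B\<^esub> f x"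
    and "x \<in> carrier A \<Longrightarrow> f (star A x) = star B (f x)"
    and "f \<in> extensional (carrier A)"
  using assms by (auto simp: cstar_hom_def ring_hom_def)

lemma cstar_homI:
  assumes "\<And>x. x \<in> carrier A \<Longrightarrow> f x \<in> carrier B"
    and "\<And>x y. \<lbrakk>x \<in> carrier A; y \<in> carrier A\<rbrakk> \<Longrightarrow> f (x \<otimes>\<^bsub>A\<^esub> y) = f x \<otimes>\<^bsub>B\<^esub> f y"
    and "\<And>x y. \<lbrakk>x \<in> carrier A; y \<in> carrier A\<rbrakk> \<Longrightarrow> f (x \<oplus>\<^bsub>A\<^esub> y) = f x \<oplus>\<^bsub>B\<^esub> f y"
    and "f \<one>\<^bsub>A\<^esub> = \<one>\<^bsub>B\<^esub>"
    and "\<And>c x. x \<in> carrier A \<Longrightarrow> f (c \<odot>\<^bsub>A\<^esub> x) = c \<odot>\<^bsub>B\<^esub> f x"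
    and "\<And>x. x \<in> carrier A \<Longrightarrow> f (star A x) = star B (f x)"
    and "f \<in> extensional (carrier A)"
  shows "f \<in> cstar_hom A B"
  using assms by (auto simp: cstar_hom_def ring_hom_def)

section \<open>Automorphisms, inner automorphisms and induction over a generated algebra\<close>

context cstar_algebra
begin

lemma cstar_hom_id: "(\<lambda>x\<in>carrier A. x) \<in> cstar_hom A A"
  by (rule cstar_homI) auto

lemma cstar_hom_compose:
  assumes f: "f \<in> cstar_hom A A" and g: "g \<in> cstar_hom A A"
  shows "compose (carrier A) f g \<in> cstar_hom A A"
  by (rule cstar_homI) (auto simp: compose_eq cstar_homD[OF f] cstar_homD[OF g])

lemma cstar_hom_inv_into:
  assumes f: "f \<in> cstar_hom A A" "f \<in> Bij (carrier A)"
  shows "(\<lambda>x\<in>carrier A. inv_into (carrier A) f x) \<in> cstar_hom A A"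
proof -
  let ?g = "inv_into (carrier A) f"
  have bij: "bij_betw f (carrier A) (carrier A)"
    using f by (simp add: Bij_def)
  have g: "?g x \<in> carrier A" "f (?g x) = x" if "x \<in> carrier A" for x
    using Bij_inv_into_mem[OF f(2) that] bij_betw_inv_into_right[OF bij that] .
  have eq: "?g x = y" if "y \<in> carrier A" "f y = x" for x y
    using bij_betw_inv_into_left[OF bij that(1)] that by simp
  show ?thesis
    by (rule cstar_homI) (auto simp: g cstar_homD[OF f(1)] intro!: eq)
qed

lemma subgroup_BijGroup: "subgroup (cstar_hom A A \<inter> Bij (carrier A)) (BijGroup (carrier A))"
proof (rule subgroup.intro)
  show "cstar_hom A A \<inter> Bij (carrier A) \<subseteq> carrier (BijGroup (carrier A))"
    by (auto simp: BijGroup_def)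
  show "x \<otimes>\<^bsub>BijGroup (carrier A)\<^esub> y \<in> cstar_hom A A \<inter> Bij (carrier A)"
    if "x \<in> cstar_hom A A \<inter> Bij (carrier A)" "y \<in> cstar_hom A A \<inter> Bij (carrier A)" for x y
    using that by (simp add: BijGroup_def cstar_hom_compose compose_Bij)
  show "\<one>\<^bsub>BijGroup (carrier A)\<^esub> \<in> cstar_hom A A \<inter> Bij (carrier A)"
    by (simp add: BijGroup_def cstar_hom_id id_Bij)
  show "inv\<^bsub>BijGroup (carrier A)\<^esub> x \<in> cstar_hom A A \<inter> Bij (carrier A)"
    if "x \<in> cstar_hom A A \<inter> Bij (carrier A)" for x
    using that by (simp add: inv_BijGroup restrict_inv_into_Bij cstar_hom_inv_into)
qed

lemma group_Aut: "group (Aut A)"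
  unfolding Aut_def by (rule subgroup.subgroup_is_group[OF subgroup_BijGroup group_BijGroup])

lemma carrier_Aut: "carrier (Aut A) = cstar_hom A A \<inter> Bij (carrier A)"
  by (simp add: Aut_def)

lemma mult_Aut:
  "\<lbrakk>f \<in> carrier (Aut A); g \<in> carrier (Aut A)\<rbrakk> \<Longrightarrow> f \<otimes>\<^bsub>Aut A\<^esub> g = compose (carrier A) f g"
  by (simp add: Aut_def BijGroup_def)

lemma one_Aut: "\<one>\<^bsub>Aut A\<^esub> = (\<lambda>x\<in>carrier A. x)"
  by (simp add: Aut_def BijGroup_def)

lemma Inn_subset_Aut: "Inn A \<subseteq> carrier (Aut A)"
proof
  fix f assume "f \<in> Inn A"
  then obtain w where w: "w \<in> unitaries A" and f: "f = (\<lambda>x\<in>carrier A. w \<otimes> x \<otimes> star A w)"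
    by (auto simp: Inn_def)
  have wc [simp]: "w \<in> carrier A" and ww: "star A w \<otimes> w = \<one>" "w \<otimes> star A w = \<one>"
    using w by (auto simp: unitaries_def)
  have cancel: "star A w \<otimes> (w \<otimes> x) = x" "w \<otimes> (star A w \<otimes> x) = x" if "x \<in> carrier A" for x
    using that ww m_assoc[of "star A w" w x] m_assoc[of w "star A w" x] by simp_all
  have "f \<in> cstar_hom A A"
    by (rule cstar_homI) (auto simp: f m_assoc cancel ww star_mult l_distr r_distr)
  moreover have "bij_betw f (carrier A) (carrier A)"
    by (rule bij_betw_byWitness[where f' = "\<lambda>x. star A w \<otimes> x \<otimes> w"])
      (auto simp: f m_assoc cancel ww)
  ultimately show "f \<in> carrier (Aut A)"
    using cstar_homD(7) by (auto simp: carrier_Aut Bij_def)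
qed

lemma one_in_Inn: "\<one>\<^bsub>Aut A\<^esub> \<in> Inn A"
proof -
  have "\<one> \<in> unitaries A"
    by (simp add: unitaries_def)
  then show ?thesis
    unfolding Inn_def one_Aut by (auto intro!: exI[of _ \<one>] restrict_ext)
qed

lemma out_proj_self:
  assumes "f \<in> carrier (Aut A)"
  shows "f \<in> out_proj A f"
proof -
  interpret Aut: group "Aut A" by (rule group_Aut)
  have "f = \<one>\<^bsub>Aut A\<^esub> \<otimes>\<^bsub>Aut A\<^esub> f"
    using assms by simp
  then show ?thesis
    using one_in_Inn unfolding out_proj_def r_coset_def by blast
qed

lemma out_proj_one: "out_proj A \<one>\<^bsub>Aut A\<^esub> = \<one>\<^bsub>Out A\<^esub>"
  using group.coset_mult_one[OF group_Aut Inn_subset_Aut]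
  by (simp add: out_proj_def Out_def FactGroup_def)

text \<open>Generation is stated for subalgebras, but the sets of interest are only closed
  subspaces. The elements that, together with their adjoints, map K into itself by left
  multiplication form a C*-subalgebra containing G. It is therefore everything, and applying it to 1
  in K puts every x = x 1 into K.\<close>

lemma generated_induct_subspace:
  assumes gen: "cstar_generated_by A G" and G: "G \<subseteq> carrier A"
    and K: "K \<subseteq> carrier A" "\<one> \<in> K"
    and add: "\<And>x y. \<lbrakk>x \<in> K; y \<in> K\<rbrakk> \<Longrightarrow> x \<oplus> y \<in> K"
    and smult: "\<And>c x. x \<in> K \<Longrightarrow> c \<odot> x \<in> K"
    and closed: "\<And>x. \<lbrakk>x \<in> carrier A; \<And>e. e > 0 \<Longrightarrow> \<exists>y\<in>K. nrm A (x \<ominus> y) < e\<rbrakk> \<Longrightarrow> x \<in> K"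
    and mult: "\<And>g x. \<lbrakk>g \<in> G; x \<in> K\<rbrakk> \<Longrightarrow> g \<otimes> x \<in> K"
      "\<And>g x. \<lbrakk>g \<in> G; x \<in> K\<rbrakk> \<Longrightarrow> star A g \<otimes> x \<in> K"
  shows "K = carrier A"
proof -
  interpret M: Metric_space "carrier A" "cstar_dist A"
    by (rule Metric_space_cstar_dist)
  define H where "H = {x \<in> carrier A. \<forall>y\<in>K. x \<otimes> y \<in> K \<and> star A x \<otimes> y \<in> K}"
  have KD: "y \<in> carrier A" if "y \<in> K" for y
    using that K by auto
  have mult_closed: "x \<otimes> y \<in> K"
    if x: "x \<in> carrier A" and y: "y \<in> K"
      and lim: "\<And>e. e > 0 \<Longrightarrow> \<exists>z\<in>carrier A. nrm A (x \<ominus> z) < e \<and> z \<otimes> y \<in> K" for x y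
  proof (rule closed)
    show "x \<otimes> y \<in> carrier A"
      using x y KD by simp
    fix e :: real assume "e > 0"
    have pos: "0 < 1 + nrm A y"
      using nrm_nonneg[OF KD[OF y]] by simp
    obtain z where z: "z \<in> carrier A" "nrm A (x \<ominus> z) < e / (1 + nrm A y)" "z \<otimes> y \<in> K"
      using lim[of "e / (1 + nrm A y)"] \<open>e > 0\<close> pos by auto
    have "x \<otimes> y \<ominus> z \<otimes> y = (x \<ominus> z) \<otimes> y"
      using x z y KD by (simp add: minus_eq l_distr l_minus)
    then have "nrm A (x \<otimes> y \<ominus> z \<otimes> y) \<le> nrm A (x \<ominus> z) * nrm A y"
      using nrm_mult[of "x \<ominus> z" y] x z y KD by simp
    also have "\<dots> \<le> nrm A (x \<ominus> z) * (1 + nrm A y)"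
      using nrm_nonneg[of "x \<ominus> z"] x z by (intro mult_left_mono) auto
    also have "\<dots> < e"
      using z(2) pos by (simp add: field_simps)
    finally show "\<exists>w\<in>K. nrm A (x \<otimes> y \<ominus> w) < e"
      using z(3) by blast
  qed
  have "cstar_subalgebra H A"
    unfolding cstar_subalgebra_def
  proof (intro conjI allI ballI)
    show "subring H A"
    proof (rule subringI)
      show "H \<subseteq> carrier A" "\<one> \<in> H"
        using KD by (auto simp: H_def)
      show "\<ominus> h \<in> H" if "h \<in> H" for h
        using that smult KD by (auto simp: H_def a_inv_eq_smult star_smult)
      show "h1 \<otimes> h2 \<in> H" if "h1 \<in> H" "h2 \<in> H" for h1 h2
        using that KD by (auto simp: H_def star_mult m_assoc)
      show "h1 \<oplus> h2 \<in> H" if "h1 \<in> H" "h2 \<in> H" for h1 h2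
        using that add KD by (auto simp: H_def star_add l_distr)
    qed
    show "c \<odot> x \<in> H" if "x \<in> H" for c x
      using that smult KD by (auto simp: H_def star_smult)
    show "star A x \<in> H" if "x \<in> H" for x
      using that by (auto simp: H_def)
    show "closedin M.mtopology H"
      unfolding M.closedin_metric
    proof (intro conjI allI impI)
      show "H \<subseteq> carrier A"
        by (auto simp: H_def)
      fix x assume x: "x \<in> carrier A - H"
      show "\<exists>r>0. disjnt H (M.mball x r)"
      proof (rule ccontr)
        assume neg: "\<not> ?thesis"
        have near: "\<exists>z\<in>H. nrm A (x \<ominus> z) < e" if "e > 0" for e
        proof -
          have "\<not> disjnt H (M.mball x e)"
            using neg that by blast
          then obtain z where "z \<in> H" "z \<in> carrier A" "cstar_dist A x z < e"
            by (auto simp: disjnt_iff)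
          then show ?thesis
            using x by (auto simp: cstar_dist_def)
        qed
        have "x \<in> H"
          unfolding H_def
        proof (intro CollectI conjI ballI)
          show xc: "x \<in> carrier A"
            using x by simp
          fix y assume y: "y \<in> K"
          show "x \<otimes> y \<in> K"
          proof (rule mult_closed[OF xc y])
            fix e :: real assume "e > 0"
            then show "\<exists>z\<in>carrier A. nrm A (x \<ominus> z) < e \<and> z \<otimes> y \<in> K"
              using near y by (force simp: H_def)
          qed
          show "star A x \<otimes> y \<in> K"
          proof (rule mult_closed[OF star_closed[OF xc] y])
            fix e :: real assume "e > 0"
            then obtain z where z: "z \<in> H" "nrm A (x \<ominus> z) < e"
              using near by blast
            have zc: "z \<in> carrier A"
              using z by (simp add: H_def)
            have "star A x \<ominus> star A z = star A (x \<ominus> z)"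
              using xc zc by (simp add: minus_eq star_add a_inv_eq_smult star_smult)
            then have "nrm A (star A x \<ominus> star A z) < e"
              using z xc zc by simp
            then show "\<exists>z\<in>carrier A. nrm A (star A x \<ominus> z) < e \<and> z \<otimes> y \<in> K"
              using z zc y by (intro bexI[of _ "star A z"]) (auto simp: H_def)
          qed
        qed
        then show False
          using x by simp
      qed
    qed
  qed
  moreover have "G \<subseteq> H"
    using G mult by (auto simp: H_def)
  ultimately have "H = carrier A"
    using gen by (simp add: cstar_generated_by_def)
  then have "x \<in> K" if "x \<in> carrier A" for x
  proof -
    have "x \<otimes> \<one> \<in> K"
      using that K(2) \<open>H = carrier A\<close> unfolding H_def by blast
    then show ?thesis
      using that by simp
  qed
  then show ?thesis
    using K by auto
qed

end

section \<open>Words, their monomials and permutation unitaries\<close>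

lemma words_0 [simp]: "words n 0 = {[]}"
  by (auto simp: words_def)

lemma words_Suc: "words n (Suc t) = (\<lambda>(i, \<alpha>). i # \<alpha>) ` ({1..n} \<times> words n t)"
  by (force simp: words_def length_Suc_conv)

lemma finite_words [simp]: "finite (words n t)"
  by (induction t) (auto simp: words_Suc)

lemma words_2: "\<alpha> \<in> words n 2 \<longleftrightarrow> (\<exists>i\<in>{1..n}. \<exists>j\<in>{1..n}. \<alpha> = [i, j])"
  by (auto simp: numeral_2_eq_2 words_Suc)

context cuntz_algebra
begin

lemma S_closed [simp]: "i \<in> {1..n} \<Longrightarrow> S i \<in> carrier A"
  using family by (simp add: cuntz_family_def)

lemma S_isometry: "\<lbrakk>i \<in> {1..n}; j \<in> {1..n}\<rbrakk> \<Longrightarrow> star A (S i) \<otimes> S j = (if i = j then \<one> else \<zero>)"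
  using family cuntz_family_orthogonal[OF family, of i j] by (auto simp: cuntz_family_def)

lemma S_sum: "(\<Oplus>i\<in>{1..n}. S i \<otimes> star A (S i)) = \<one>"
  using family by (simp add: cuntz_family_def)

lemma S_word_Nil [simp]: "S_word A V [] = \<one>"
  by (simp add: S_word_def)

lemma S_word_Cons [simp]: "S_word A V (i # \<alpha>) = V i \<otimes> S_word A V \<alpha>"
  by (simp add: S_word_def)

lemma S_word_closed:
  "\<lbrakk>V \<in> {1..n} \<rightarrow> carrier A; set \<alpha> \<subseteq> {1..n}\<rbrakk> \<Longrightarrow> S_word A V \<alpha> \<in> carrier A"
  by (induction \<alpha>) auto

lemma S_word_S_closed [simp]: "set \<alpha> \<subseteq> {1..n} \<Longrightarrow> S_word A S \<alpha> \<in> carrier A"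
  by (rule S_word_closed) auto

lemma S_word_append:
  "\<lbrakk>V \<in> {1..n} \<rightarrow> carrier A; set \<alpha> \<subseteq> {1..n}; set \<beta> \<subseteq> {1..n}\<rbrakk>
    \<Longrightarrow> S_word A V (\<alpha> @ \<beta>) = S_word A V \<alpha> \<otimes> S_word A V \<beta>"
  by (induction \<alpha>) (auto simp: S_word_closed m_assoc Pi_iff)

lemma words_S_closed [simp]: "\<alpha> \<in> words n t \<Longrightarrow> S_word A S \<alpha> \<in> carrier A"
  by (simp add: words_def)

lemma star_S_cancel:
  assumes "i \<in> {1..n}" "j \<in> {1..n}" "x \<in> carrier A"
  shows "star A (S i) \<otimes> (S j \<otimes> x) = (if i = j then x else \<zero>)"
  using assms S_isometry[of i j] m_assoc[of "star A (S i)" "S j" x] by auto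

lemma star_word_Cons_mult_Cons:
  assumes "i \<in> {1..n}" "j \<in> {1..n}" "x \<in> carrier A" "y \<in> carrier A"
  shows "star A (S i \<otimes> x) \<otimes> (S j \<otimes> y) = (if i = j then star A x \<otimes> y else \<zero>)"
  using assms by (simp add: star_mult m_assoc star_S_cancel)

text \<open>Stripping equal first letters, S_alpha^* S_beta survives only if one word is a prefix of
  the other. The lengths may differ; contrapositively, one differing letter at a common position
  kills the product, which is how vanishing is detected later.\<close>

lemma star_word_mult_nonzero:
  assumes "set \<alpha> \<subseteq> {1..n}" "set \<beta> \<subseteq> {1..n}" "star A (S_word A S \<alpha>) \<otimes> S_word A S \<beta> \<noteq> \<zero>"
    and "k < length \<alpha>" "k < length \<beta>"
  shows "\<alpha> ! k = \<beta> ! k"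
  using assms
proof (induction \<alpha> arbitrary: \<beta> k)
  case (Cons i \<alpha>)
  then obtain j \<beta>' where \<beta>: "\<beta> = j # \<beta>'"
    by (cases \<beta>) auto
  have eq: "i = j \<and> star A (S_word A S \<alpha>) \<otimes> S_word A S \<beta>' \<noteq> \<zero>"
    using Cons.prems \<beta> by (auto simp: star_word_Cons_mult_Cons split: if_splits)
  then show ?case
    using Cons \<beta> by (cases k) auto
qed simp

lemma star_word_mult:
  assumes "\<alpha> \<in> words n t" "\<beta> \<in> words n t"
  shows "star A (S_word A S \<alpha>) \<otimes> S_word A S \<beta> = (if \<alpha> = \<beta> then \<one> else \<zero>)"
  using assms
proof (induction t arbitrary: \<alpha> \<beta>)
  case (Suc t)
  then show ?case
    by (auto simp: words_Suc star_word_Cons_mult_Cons split: if_splits)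
qed simp

text \<open>Insert 1, written as the sum of all S_i S_i^*, on the right of both elements.\<close>

lemma eq_by_generators:
  assumes "x \<in> carrier A" "y \<in> carrier A" "\<And>i. i \<in> {1..n} \<Longrightarrow> x \<otimes> S i = y \<otimes> S i"
  shows "x = y"
proof -
  have *: "z = (\<Oplus>i\<in>{1..n}. (z \<otimes> S i) \<otimes> star A (S i))" if "z \<in> carrier A" for z
  proof -
    have "z = z \<otimes> (\<Oplus>i\<in>{1..n}. S i \<otimes> star A (S i))"
      using S_sum that by simp
    also have "\<dots> = (\<Oplus>i\<in>{1..n}. (z \<otimes> S i) \<otimes> star A (S i))"
      using that by (subst finsum_rdistr) (auto simp: m_assoc intro!: finsum_cong')
    finally show ?thesis .
  qed
  have "(\<Oplus>i\<in>{1..n}. (x \<otimes> S i) \<otimes> star A (S i)) = (\<Oplus>i\<in>{1..n}. (y \<otimes> S i) \<otimes> star A (S i))"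
    using assms by (intro finsum_cong') auto
  then show ?thesis
    using *[OF assms(1)] *[OF assms(2)] by simp
qed

lemma eq_by_words:
  assumes "x \<in> carrier A" "y \<in> carrier A"
    and "\<And>\<beta>. \<beta> \<in> words n t \<Longrightarrow> x \<otimes> S_word A S \<beta> = y \<otimes> S_word A S \<beta>"
  shows "x = y"
  using assms
proof (induction t arbitrary: x y)
  case (Suc t)
  show ?case
  proof (rule eq_by_generators)
    fix i assume i: "i \<in> {1..n}"
    show "x \<otimes> S i = y \<otimes> S i"
    proof (rule Suc.IH)
      fix \<beta> assume \<beta>: "\<beta> \<in> words n t"
      then have "x \<otimes> S_word A S (i # \<beta>) = y \<otimes> S_word A S (i # \<beta>)"
        using i by (intro Suc.prems) (auto simp: words_Suc)
      then show "x \<otimes> S i \<otimes> S_word A S \<beta> = y \<otimes> S i \<otimes> S_word A S \<beta>"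
        using i \<beta> Suc.prems by (simp add: m_assoc)
    qed (use Suc.prems i in auto)
  qed (use Suc.prems in auto)
qed simp

text \<open>The images f(S_i) form a Cuntz family in \<open>A\<close> itself, so both maps are the
  unique homomorphism that universality provides for this family.\<close>

lemma cstar_hom_eqI:
  assumes f: "f \<in> cstar_hom A A" and g: "g \<in> cstar_hom A A"
    and eq: "\<And>i. i \<in> {1..n} \<Longrightarrow> f (S i) = g (S i)"
  shows "f = g"
proof -
  have f_sum: "f (\<Oplus>i\<in>I. h i) = (\<Oplus>i\<in>I. f (h i))" if "finite I" "h \<in> I \<rightarrow> carrier A" for I h
    using that
  proof (induction I rule: finite_induct)
    case empty
    have "f (0 \<odot> \<one>) = 0 \<odot> f \<one>"
      by (rule cstar_homD(5)[OF f]) simp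
    then show ?case
      using cstar_homD[OF f] by simp
  next
    case (insert i I)
    then show ?case
      using cstar_homD[OF f] by (simp add: Pi_iff finsum_closed)
  qed
  have "cuntz_family A n (\<lambda>i. f (S i))"
    unfolding cuntz_family_def
  proof (intro conjI ballI)
    fix i assume i: "i \<in> {1..n}"
    show "f (S i) \<in> carrier A"
      using cstar_homD[OF f] i by simp
    have "star A (f (S i)) \<otimes> f (S i) = f (star A (S i) \<otimes> S i)"
      using cstar_homD[OF f] i by simp
    then show "star A (f (S i)) \<otimes> f (S i) = \<one>"
      using cstar_homD[OF f] i S_isometry by simp
  next
    have "(\<Oplus>i\<in>{1..n}. f (S i) \<otimes> star A (f (S i))) = (\<Oplus>i\<in>{1..n}. f (S i \<otimes> star A (S i)))"
      using cstar_homD[OF f] by (intro finsum_cong') auto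
    also have "\<dots> = f (\<Oplus>i\<in>{1..n}. S i \<otimes> star A (S i))"
      by (subst f_sum) auto
    finally show "(\<Oplus>i\<in>{1..n}. f (S i) \<otimes> star A (f (S i))) = \<one>"
      using cstar_homD[OF f] S_sum by simp
  qed
  from universal[OF cstar_algebra_axioms this] show ?thesis
    using f g eq by metis
qed

lemma perm_word_closed [simp]:
  "\<lbrakk>u permutes words n t; \<alpha> \<in> words n t\<rbrakk> \<Longrightarrow> S_word A S (u \<alpha>) \<in> carrier A"
  by (rule words_S_closed[where t = t]) (simp add: permutes_in_image)

lemma perm_unitary_closed [simp]:
  assumes "u permutes words n t"
  shows "perm_unitary A n S t u \<in> carrier A"
  using assms unfolding perm_unitary_def by (intro finsum_closed) auto

lemma perm_unitary_mult_word:
  assumes u: "u permutes words n t" and \<beta>: "\<beta> \<in> words n t"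
  shows "perm_unitary A n S t u \<otimes> S_word A S \<beta> = S_word A S (u \<beta>)"
proof -
  note in_u = permutes_in_image[OF u]
  have "perm_unitary A n S t u \<otimes> S_word A S \<beta>
      = (\<Oplus>\<alpha>\<in>words n t. S_word A S (u \<alpha>) \<otimes> star A (S_word A S \<alpha>) \<otimes> S_word A S \<beta>)"
    unfolding perm_unitary_def using u in_u \<beta> by (intro finsum_ldistr) auto
  also have "\<dots> = (\<Oplus>\<alpha>\<in>words n t. if \<beta> = \<alpha> then S_word A S (u \<alpha>) else \<zero>)"
    using u in_u \<beta> by (intro finsum_cong') (auto simp: m_assoc star_word_mult[where t = t])
  also have "\<dots> = S_word A S (u \<beta>)"
    using u in_u \<beta> by (intro finsum_singleton) auto
  finally show ?thesis .
qed

lemma star_perm_unitary_mult_word: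
  assumes u: "u permutes words n t" and \<beta>: "\<beta> \<in> words n t"
  shows "star A (perm_unitary A n S t u) \<otimes> S_word A S (u \<beta>) = S_word A S \<beta>"
proof -
  note in_u = permutes_in_image[OF u]
  have "star A (perm_unitary A n S t u) = (\<Oplus>\<alpha>\<in>words n t. S_word A S \<alpha> \<otimes> star A (S_word A S (u \<alpha>)))"
    unfolding perm_unitary_def using u in_u
    by (subst star_finsum) (auto simp: star_mult intro!: finsum_cong')
  then have "star A (perm_unitary A n S t u) \<otimes> S_word A S (u \<beta>)
      = (\<Oplus>\<alpha>\<in>words n t. S_word A S \<alpha> \<otimes> star A (S_word A S (u \<alpha>)) \<otimes> S_word A S (u \<beta>))"
    using u in_u \<beta> by (simp add: finsum_ldistr Pi_iff)
  also have "\<dots> = (\<Oplus>\<alpha>\<in>words n t. if \<beta> = \<alpha> then S_word A S \<alpha> else \<zero>)"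
    using u in_u \<beta> permutes_inj[OF u]
    by (intro finsum_cong') (auto simp: m_assoc star_word_mult[where t = t] inj_eq)
  also have "\<dots> = S_word A S \<beta>"
    using u in_u \<beta> by (intro finsum_singleton) auto
  finally show ?thesis .
qed

lemma perm_unitary_unitary:
  assumes u: "u permutes words n t"
  shows "perm_unitary A n S t u \<in> unitaries A"
proof -
  let ?U = "perm_unitary A n S t u"
  have U [simp]: "?U \<in> carrier A"
    using u by simp
  note in_u = permutes_in_image[OF u]
  have "star A ?U \<otimes> ?U = \<one>"
    by (rule eq_by_words[where t = t])
      (use u in_u in \<open>auto simp: m_assoc perm_unitary_mult_word star_perm_unitary_mult_word\<close>)
  moreover have "?U \<otimes> star A ?U = \<one>"
  proof (rule eq_by_words[where t = t])
    fix \<gamma> assume \<gamma>: "\<gamma> \<in> words n t"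
    then obtain \<beta> where "\<beta> \<in> words n t" "\<gamma> = u \<beta>"
      using permutes_image[OF u] by auto
    then show "?U \<otimes> star A ?U \<otimes> S_word A S \<gamma> = \<one> \<otimes> S_word A S \<gamma>"
      using u in_u by (auto simp: m_assoc perm_unitary_mult_word star_perm_unitary_mult_word)
  qed auto
  ultimately show ?thesis
    by (simp add: unitaries_def)
qed

lemma perm_unitary_cong:
  assumes "\<And>\<alpha>. \<alpha> \<in> words n t \<Longrightarrow> u \<alpha> = v \<alpha>" "u permutes words n t"
  shows "perm_unitary A n S t u = perm_unitary A n S t v"
proof -
  have "S_word A S (v \<alpha>) \<in> carrier A" if "\<alpha> \<in> words n t" for \<alpha>
    using perm_word_closed[OF assms(2) that] assms(1)[OF that] by simp
  then show ?thesis
    unfolding perm_unitary_def using assms(1) by (intro finsum_cong') auto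
qed

lemma lam_perm:
  assumes "u permutes words n t"
  defines "U \<equiv> perm_unitary A n S t u"
  shows "lam A n S U \<in> cstar_hom A A" "i \<in> {1..n} \<Longrightarrow> lam A n S U (S i) = U \<otimes> S i"
  using theI'[OF lam_well_defined[OF perm_unitary_unitary[OF assms(1)]]]
  unfolding lam_def U_def by auto

end

section \<open>Rectangular bands and block codes\<close>

text \<open>The last clause contains associativity: both bracketings of a triple product reduce to
  the product of the outer letters.\<close>

definition rect_band :: "nat \<Rightarrow> (nat \<Rightarrow> nat \<Rightarrow> nat) \<Rightarrow> bool" where
  "rect_band n m \<longleftrightarrow> (\<forall>i\<in>{1..n}. \<forall>j\<in>{1..n}. m i j \<in> {1..n}) \<and> (\<forall>i\<in>{1..n}. m i i = i) \<and>
     (\<forall>i\<in>{1..n}. \<forall>j\<in>{1..n}. \<forall>k\<in>{1..n}. m (m i j) k = m i k \<and> m i (m j k) = m i k)"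

text \<open>Through the bijection [i, j] |-> (i * j, j * i) of pairs, this is \<sigma> on the first
  component and the identity on the second. Outside \<open>words n 2\<close> it is the identity, as
  \<open>permutes\<close> demands.\<close>

definition band_perm :: "nat \<Rightarrow> (nat \<Rightarrow> nat \<Rightarrow> nat) \<Rightarrow> (nat \<Rightarrow> nat) \<Rightarrow> nat list \<Rightarrow> nat list" where
  "band_perm n m \<sigma> \<alpha> =
     (if \<alpha> \<in> words n 2
      then let i = \<alpha> ! 0; j = \<alpha> ! 1; z = \<sigma> (m i j) in [m z i, m j z] else \<alpha>)"

context
  fixes n :: nat and m :: "nat \<Rightarrow> nat \<Rightarrow> nat"
  assumes band: "rect_band n m"
begin

lemma band_closed: "\<lbrakk>i \<in> {1..n}; j \<in> {1..n}\<rbrakk> \<Longrightarrow> m i j \<in> {1..n}"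
  using band unfolding rect_band_def by blast

lemma band_idem: "i \<in> {1..n} \<Longrightarrow> m i i = i"
  using band unfolding rect_band_def by blast

lemma band_left: "\<lbrakk>i \<in> {1..n}; j \<in> {1..n}; k \<in> {1..n}\<rbrakk> \<Longrightarrow> m (m i j) k = m i k"
  using band unfolding rect_band_def by blast

lemma band_right: "\<lbrakk>i \<in> {1..n}; j \<in> {1..n}; k \<in> {1..n}\<rbrakk> \<Longrightarrow> m i (m j k) = m i k"
  using band unfolding rect_band_def by blast

lemmas band_rules = band_closed band_idem band_left band_right

lemma permutes_letter: "\<lbrakk>\<sigma> permutes {1..n}; i \<in> {1..n}\<rbrakk> \<Longrightarrow> \<sigma> i \<in> {1..n}"
  by (simp only: permutes_in_image)

lemma band_perm_word:
  "\<lbrakk>i \<in> {1..n}; j \<in> {1..n}\<rbrakk> \<Longrightarrow> band_perm n m \<sigma> [i, j] = [m (\<sigma> (m i j)) i, m j (\<sigma> (m i j))]"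
  unfolding band_perm_def words_2 by (auto simp: Let_def)

lemma band_perm_closed:
  assumes "\<sigma> permutes {1..n}" "\<alpha> \<in> words n 2"
  shows "band_perm n m \<sigma> \<alpha> \<in> words n 2"
proof -
  obtain i j where ij: "i \<in> {1..n}" "j \<in> {1..n}" "\<alpha> = [i, j]"
    using assms(2) words_2 by blast
  then show ?thesis
    unfolding words_2 ij(3) band_perm_word[OF ij(1,2)]
    using band_closed permutes_letter[OF assms(1)] by blast
qed

text \<open>With z = \<tau>(i * j) the new pair multiplies to (z * i) * (j * z) = z, so \<sigma> is
  applied to exactly \<tau>(i * j); the old z is then absorbed, since \<sigma>(z) * (z * i) =
  \<sigma>(z) * i.\<close>

lemma band_perm_comp:
  assumes "\<sigma> permutes {1..n}" "\<tau> permutes {1..n}" "\<alpha> \<in> words n 2"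
  shows "band_perm n m \<sigma> (band_perm n m \<tau> \<alpha>) = band_perm n m (\<sigma> \<circ> \<tau>) \<alpha>"
proof -
  obtain i j where ij: "i \<in> {1..n}" "j \<in> {1..n}" "\<alpha> = [i, j]"
    using assms(3) words_2 by blast
  have z: "\<tau> (m i j) \<in> {1..n}" "\<sigma> (\<tau> (m i j)) \<in> {1..n}"
    using ij band_closed permutes_letter[OF assms(1)] permutes_letter[OF assms(2)] by blast+
  show ?thesis
    using ij(1,2) z unfolding ij(3) by (simp only: band_perm_word band_rules o_def)
qed

lemma band_perm_id: "\<alpha> \<in> words n 2 \<Longrightarrow> band_perm n m id \<alpha> = \<alpha>"
  unfolding words_2 by (auto simp only: band_perm_word band_rules id_apply)

lemma band_perm_permutes:
  assumes \<sigma>: "\<sigma> permutes {1..n}"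
  shows "band_perm n m \<sigma> permutes words n 2"
proof (rule bij_imp_permutes)
  let ?\<tau> = "inv_into UNIV \<sigma>"
  have \<tau>: "?\<tau> permutes {1..n}"
    using \<sigma> by (rule permutes_inv)
  show "bij_betw (band_perm n m \<sigma>) (words n 2) (words n 2)"
    using permutes_inv_o[OF \<sigma>]
    by (intro bij_betw_byWitness[where f' = "band_perm n m ?\<tau>"])
      (auto simp: band_perm_comp[OF \<sigma> \<tau>] band_perm_comp[OF \<tau> \<sigma>] band_perm_id band_perm_closed[OF \<sigma>] band_perm_closed[OF \<tau>])
qed (simp add: band_perm_def)

end

text \<open>The word obtained by applying the permutation of \<open>band_perm\<close> to all adjacent pairs of letters,
  from right to left. The band laws turn this into a sliding block code: see \<open>band_code_nth\<close>.\<close>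

fun band_code :: "(nat \<Rightarrow> nat \<Rightarrow> nat) \<Rightarrow> (nat \<Rightarrow> nat) \<Rightarrow> nat list \<Rightarrow> nat list" where
  "band_code m \<sigma> (i # j # \<alpha>) =
     (let z = \<sigma> (m i j); \<beta> = band_code m \<sigma> (j # \<alpha>) in m z i # m (hd \<beta>) z # tl \<beta>)"
| "band_code m \<sigma> \<alpha> = \<alpha>"

text \<open>In coordinates, letter k takes its first coordinate from the pair starting at k and its
  second from the pair ending at k. At k = 0 truncated subtraction makes the second pair (a 0, a 0),
  so periodicity and the comparison with \<open>band_code\<close> are claimed only for k >=
  1.\<close>

definition block_code :: "(nat \<Rightarrow> nat \<Rightarrow> nat) \<Rightarrow> (nat \<Rightarrow> nat) \<Rightarrow> (nat \<Rightarrow> nat) \<Rightarrow> nat \<Rightarrow> nat" where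
  "block_code m \<sigma> a k = m (\<sigma> (m (a k) (a (k + 1)))) (\<sigma> (m (a (k - 1)) (a k)))"

lemma length_band_code [simp]: "length (band_code m \<sigma> \<alpha>) = length \<alpha>"
  by (induction m \<sigma> \<alpha> rule: band_code.induct) (auto simp: Let_def)

lemma band_code_Cons_hd_tl:
  "band_code m \<sigma> (j # \<alpha>) = hd (band_code m \<sigma> (j # \<alpha>)) # tl (band_code m \<sigma> (j # \<alpha>))"
  by (rule list.collapse[symmetric]) (metis length_band_code length_0_conv list.distinct(1))

context
  fixes n :: nat and m :: "nat \<Rightarrow> nat \<Rightarrow> nat" and \<sigma> :: "nat \<Rightarrow> nat"
  assumes band: "rect_band n m" and \<sigma>: "\<sigma> permutes {1..n}"
begin

text \<open>Coding a word changes its first letter j at most in the first coordinate, while i * j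
  reads only the second coordinate of j. Hence the next pair permutation to the left still sees the
  product of the original letters.\<close>

lemma hd_band_code:
  assumes "set (j # \<alpha>) \<subseteq> {1..n}"
  shows "hd (band_code m \<sigma> (j # \<alpha>)) \<in> {1..n} \<and>
    (\<forall>i\<in>{1..n}. m i (hd (band_code m \<sigma> (j # \<alpha>))) = m i j)"
proof (cases \<alpha>)
  case (Cons k \<beta>)
  have jk: "j \<in> {1..n}" "k \<in> {1..n}"
    using assms Cons by auto
  then have z: "\<sigma> (m j k) \<in> {1..n}"
    using band_closed[OF band] permutes_letter[OF band \<sigma>] by blast
  have hd: "hd (band_code m \<sigma> (j # \<alpha>)) = m (\<sigma> (m j k)) j"
    by (simp add: Cons Let_def)
  show ?thesis
    unfolding hd using jk z band_closed[OF band] band_right[OF band] by blast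
qed (use assms in auto)

lemma set_band_code: "set \<alpha> \<subseteq> {1..n} \<Longrightarrow> set (band_code m \<sigma> \<alpha>) \<subseteq> {1..n}"
proof (induction \<alpha>)
  case (Cons i \<alpha>)
  show ?case
  proof (cases \<alpha>)
    case Nil
    then show ?thesis using Cons.prems by simp
  next
    case (Cons j \<beta>)
    have ij: "i \<in> {1..n}" "j \<in> {1..n}" "set (j # \<beta>) \<subseteq> {1..n}"
      using Cons.prems Cons by auto
    then have z: "\<sigma> (m i j) \<in> {1..n}"
      using band_closed[OF band] permutes_letter[OF band \<sigma>] by blast
    have h: "hd (band_code m \<sigma> (j # \<beta>)) \<in> {1..n}"
      using hd_band_code[OF ij(3)] by blast
    have IH: "set (band_code m \<sigma> (j # \<beta>)) \<subseteq> {1..n}"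
      using Cons.IH ij unfolding Cons by blast
    then have "set (tl (band_code m \<sigma> (j # \<beta>))) \<subseteq> {1..n}"
      by (subst (asm) band_code_Cons_hd_tl) simp
    moreover have "band_code m \<sigma> (i # \<alpha>) =
        m (\<sigma> (m i j)) i # m (hd (band_code m \<sigma> (j # \<beta>))) (\<sigma> (m i j)) # tl (band_code m \<sigma> (j # \<beta>))"
      by (simp add: Cons Let_def)
    ultimately show ?thesis
      using band_closed[OF band z ij(1)] band_closed[OF band h z] by simp
  qed
qed simp

text \<open>An interior letter is rewritten first by the pair to its right, which replaces its first
  coordinate, and then by the pair to its left, which replaces its second. The two end letters are
  rewritten at most once, whence the bounds on k.\<close>

lemma band_code_nth:
  assumes "set \<alpha> \<subseteq> {1..n}" "0 < k" "k + 1 < length \<alpha>"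
  shows "band_code m \<sigma> \<alpha> ! k =
    m (\<sigma> (m (\<alpha> ! k) (\<alpha> ! (k + 1)))) (\<sigma> (m (\<alpha> ! (k - 1)) (\<alpha> ! k)))"
  using assms
proof (induction \<alpha> arbitrary: k)
  case (Cons i \<alpha>)
  then obtain j l \<beta> where \<alpha>: "\<alpha> = j # l # \<beta>"
    by (cases \<alpha> rule: remdups_adj.cases) auto
  have letters: "i \<in> {1..n}" "j \<in> {1..n}" "l \<in> {1..n}"
    using Cons.prems \<alpha> by auto
  define z where "z = \<sigma> (m i j)"
  define y where "y = \<sigma> (m j l)"
  have zy: "z \<in> {1..n}" "y \<in> {1..n}"
    using letters band_closed[OF band] permutes_letter[OF band \<sigma>] unfolding z_def y_def by blast+
  define \<gamma> where "\<gamma> = band_code m \<sigma> (j # l # \<beta>)"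
  have code: "band_code m \<sigma> (i # \<alpha>) = m z i # m (hd \<gamma>) z # tl \<gamma>"
    by (simp add: \<alpha> z_def \<gamma>_def Let_def del: band_code.simps(1)) (simp add: Let_def)
  show ?case
  \<comment> \<open>Prepending i to the coded suffix touches only positions 0 and 1; beyond them the
    induction hypothesis applies to the shifted index.\<close>
  proof (cases "k = 1")
    case True
    have hd: "hd \<gamma> = m y j"
      by (simp add: \<gamma>_def y_def Let_def)
    have "band_code m \<sigma> (i # \<alpha>) ! k = m (m y j) z"
      by (simp only: code True hd nth_Cons_Suc nth_Cons_0 One_nat_def)
    also have "\<dots> = m y z"
      by (rule band_left[OF band zy(2) letters(2) zy(1)])
    also have "\<dots> = m (\<sigma> (m ((i # \<alpha>) ! k) ((i # \<alpha>) ! (k + 1)))) (\<sigma> (m ((i # \<alpha>) ! (k - 1)) ((i # \<alpha>) ! k)))"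
      by (simp add: True \<alpha> z_def y_def)
    finally show ?thesis .
  next
    case False
    define k' where "k' = k - 2"
    then have k: "k = Suc (Suc k')"
      using False Cons.prems(2) by simp
    have len: "length \<gamma> = length \<alpha>"
      by (simp add: \<gamma>_def \<alpha> del: band_code.simps)
    have "band_code m \<sigma> (i # \<alpha>) ! k = tl \<gamma> ! k'"
      by (simp add: code k)
    also have "\<dots> = \<gamma> ! Suc k'"
      using Cons.prems(3) len k by (intro nth_tl) simp
    also have "\<dots> = m (\<sigma> (m (\<alpha> ! Suc k') (\<alpha> ! (Suc k' + 1)))) (\<sigma> (m (\<alpha> ! (Suc k' - 1)) (\<alpha> ! Suc k')))"
      unfolding \<gamma>_def \<alpha>[symmetric] using Cons.prems k by (intro Cons.IH) auto
    finally show ?thesis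
      by (simp add: k)
  qed
qed simp

end

text \<open>The offsets p and q are independent because S_mu S_nu^* aligns the two codes after |mu|
  and |nu| letters respectively.\<close>

definition no_common_tail :: "(nat \<Rightarrow> 'b) \<Rightarrow> (nat \<Rightarrow> 'b) \<Rightarrow> bool" where
  "no_common_tail b c \<longleftrightarrow> (\<forall>p q K. \<exists>k\<ge>K. b (p + k) \<noteq> c (q + k))"

section \<open>A vanishing criterion for elements fixed by compressions\<close>

context cuntz_algebra
begin

lemma nrm_S_word_le: "set \<alpha> \<subseteq> {1..n} \<Longrightarrow> nrm A (S_word A S \<alpha>) \<le> 1"
  by (rule nrm_isometry_le) (use star_word_mult[of \<alpha> "length \<alpha>" \<alpha>] in \<open>auto simp: words_def\<close>)

lemma star_S_word_mult_S:
  assumes "set \<nu> \<subseteq> {1..n}" "i \<in> {1..n}"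
  shows "star A (S_word A S \<nu>) \<otimes> S i =
    (case \<nu> of [] \<Rightarrow> S i | j # \<nu>' \<Rightarrow> if i = j then star A (S_word A S \<nu>') else \<zero>)"
  using assms star_word_Cons_mult_Cons[of _ i _ \<one>]
  by (cases \<nu>) auto

text \<open>The maps x |-> star (p M) x (q M) do not increase norms and tend to 0 on every S_mu
  S_nu^*, hence on the closed span, which is everything. As w is fixed by all of them, it is
  0.\<close>

lemma intertwiner_eq_zero:
  assumes p: "\<And>M. p M \<in> carrier A" "\<And>M. nrm A (p M) \<le> 1"
    and q: "\<And>M. q M \<in> carrier A" "\<And>M. nrm A (q M) \<le> 1"
    and van: "\<And>\<mu> \<nu>. \<lbrakk>set \<mu> \<subseteq> {1..n}; set \<nu> \<subseteq> {1..n}\<rbrakk> \<Longrightarrow>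
       \<forall>\<^sub>F M in sequentially. star A (p M) \<otimes> (S_word A S \<mu> \<otimes> star A (S_word A S \<nu>)) \<otimes> q M = \<zero>"
    and w: "w \<in> carrier A" "\<And>M. star A (p M) \<otimes> w \<otimes> q M = w"
  shows "w = \<zero>"
proof -
  define N where "N x M = nrm A (star A (p M) \<otimes> x \<otimes> q M)" for x M
  define Z where "Z = {x \<in> carrier A. N x \<longlonglongrightarrow> 0}"
  \<comment> \<open>Left multiplication by a generator does not visibly preserve \<open>Z\<close>,
    so the induction runs over the subspace \<open>K\<close>, which has all left factors S_mu S_nu^*
    built in.\<close>
  define K where "K = {x \<in> carrier A. \<forall>\<mu> \<nu>. set \<mu> \<subseteq> {1..n} \<longrightarrow> set \<nu> \<subseteq> {1..n} \<longrightarrow>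
    S_word A S \<mu> \<otimes> (star A (S_word A S \<nu>) \<otimes> x) \<in> Z}"
  have N_nonneg: "0 \<le> N x M" if "x \<in> carrier A" for x M
    using that p q by (simp add: N_def nrm_nonneg)
  have N_add: "N (x \<oplus> y) M \<le> N x M + N y M" if "x \<in> carrier A" "y \<in> carrier A" for x y M
    using that p q nrm_triangle by (simp add: N_def l_distr r_distr)
  have N_smult: "N (c \<odot> x) M = cmod c * N x M" if "x \<in> carrier A" for c x M
    using that p q by (simp add: N_def nrm_smult)
  have N_le: "N x M \<le> nrm A x" if "x \<in> carrier A" for x M
  proof -
    have "N x M \<le> nrm A (star A (p M) \<otimes> x) * nrm A (q M)"
      using that p q by (simp add: N_def nrm_mult)
    also have "\<dots> \<le> nrm A (star A (p M) \<otimes> x) * 1"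
      using that p q by (intro mult_left_mono nrm_nonneg) auto
    also have "\<dots> \<le> nrm A (star A (p M)) * nrm A x"
      using that p nrm_mult[of "star A (p M)" x] by simp
    also have "\<dots> \<le> 1 * nrm A x"
      using that p by (intro mult_right_mono nrm_nonneg) auto
    finally show ?thesis by simp
  qed
  have Z_add: "x \<oplus> y \<in> Z" if "x \<in> Z" "y \<in> Z" for x y
  proof -
    have xy: "x \<in> carrier A" "y \<in> carrier A" "N x \<longlonglongrightarrow> 0" "N y \<longlonglongrightarrow> 0"
      using that by (auto simp: Z_def)
    have "(\<lambda>M. N x M + N y M) \<longlonglongrightarrow> 0"
      using tendsto_add[OF xy(3,4)] by simp
    then have "N (x \<oplus> y) \<longlonglongrightarrow> 0"
      using xy N_add N_nonneg
      by (intro tendsto_sandwich[OF _ _ tendsto_const[of 0], of "N (x \<oplus> y)" _ "\<lambda>M. N x M + N y M"]) auto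
    then show ?thesis
      using xy by (simp add: Z_def)
  qed
  have Z_smult: "c \<odot> x \<in> Z" if "x \<in> Z" for c x
  proof -
    have x: "x \<in> carrier A" "N x \<longlonglongrightarrow> 0"
      using that by (auto simp: Z_def)
    have "(\<lambda>M. cmod c * N x M) \<longlonglongrightarrow> 0"
      using tendsto_mult_left[OF x(2), of "cmod c"] by simp
    moreover have "N (c \<odot> x) = (\<lambda>M. cmod c * N x M)"
      using N_smult[OF x(1)] by auto
    ultimately show ?thesis
      using x by (simp add: Z_def)
  qed
  have Z_closed: "x \<in> Z"
    if x: "x \<in> carrier A" and lim: "\<And>e. e > 0 \<Longrightarrow> \<exists>y\<in>Z. nrm A (x \<ominus> y) < e" for x
  proof -
    have "N x \<longlonglongrightarrow> 0"
    proof (rule LIMSEQ_I)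
      fix r :: real assume "r > 0"
      then obtain y where y: "y \<in> carrier A" "N y \<longlonglongrightarrow> 0" "nrm A (x \<ominus> y) < r / 2"
        using lim[of "r / 2"] by (auto simp: Z_def)
      obtain M0 where M0: "\<And>M. M \<ge> M0 \<Longrightarrow> norm (N y M - 0) < r / 2"
        using LIMSEQ_D[OF y(2), of "r / 2"] \<open>r > 0\<close> by auto
      have "norm (N x M - 0) < r" if "M \<ge> M0" for M
      proof -
        have "x = (x \<ominus> y) \<oplus> y"
          using x y by (simp add: minus_eq a_assoc l_neg)
        then have "N x M \<le> N (x \<ominus> y) M + N y M"
          using N_add[of "x \<ominus> y" y M] x y by simp
        also have "\<dots> < r / 2 + r / 2"
          using N_le[of "x \<ominus> y" M] M0[OF that] x y by (intro add_strict_mono) auto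
        finally show ?thesis
          using N_nonneg[OF x] by simp
      qed
      then show "\<exists>M0. \<forall>M\<ge>M0. norm (N x M - 0) < r"
        by blast
    qed
    then show ?thesis
      using x by (simp add: Z_def)
  qed
  have Z_zero: "\<zero> \<in> Z"
  proof -
    have "N \<zero> = (\<lambda>_. 0)"
      using p q by (auto simp: N_def)
    then show ?thesis
      by (simp add: Z_def)
  qed
  have KD: "x \<in> carrier A" "\<lbrakk>set \<mu> \<subseteq> {1..n}; set \<nu> \<subseteq> {1..n}\<rbrakk> \<Longrightarrow>
      S_word A S \<mu> \<otimes> (star A (S_word A S \<nu>) \<otimes> x) \<in> Z" if "x \<in> K" for x \<mu> \<nu>
    using that by (auto simp: K_def)
  have "K = carrier A"
  proof (rule generated_induct_subspace[OF generated])
    show "S ` {1..n} \<subseteq> carrier A" "K \<subseteq> carrier A"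
      by (auto simp: K_def)
    show "\<one> \<in> K"
      unfolding K_def
    proof (intro CollectI conjI allI impI)
      fix \<mu> \<nu> assume \<mu>\<nu>: "set \<mu> \<subseteq> {1..n}" "set \<nu> \<subseteq> {1..n}"
      have "\<forall>\<^sub>F M in sequentially. N (S_word A S \<mu> \<otimes> star A (S_word A S \<nu>)) M = 0"
        using van[OF \<mu>\<nu>] by eventually_elim (simp add: N_def)
      then show "S_word A S \<mu> \<otimes> (star A (S_word A S \<nu>) \<otimes> \<one>) \<in> Z"
        using \<mu>\<nu> by (simp add: Z_def tendsto_eventually)
    qed simp
    show "x \<oplus> y \<in> K" if "x \<in> K" "y \<in> K" for x y
      using that Z_add by (auto simp: K_def r_distr)
    show "c \<odot> x \<in> K" if "x \<in> K" for c x
      using that Z_smult by (auto simp: K_def)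
    show "x \<in> K" if x: "x \<in> carrier A" and lim: "\<And>e. e > 0 \<Longrightarrow> \<exists>y\<in>K. nrm A (x \<ominus> y) < e" for x
      unfolding K_def
    proof (intro CollectI conjI allI impI)
      fix \<mu> \<nu> assume \<mu>\<nu>: "set \<mu> \<subseteq> {1..n}" "set \<nu> \<subseteq> {1..n}"
      let ?a = "S_word A S \<mu> \<otimes> star A (S_word A S \<nu>)"
      have a: "?a \<in> carrier A" "nrm A ?a \<le> 1"
        using \<mu>\<nu> \<mu>\<nu>[THEN nrm_S_word_le] by (auto intro!: nrm_mult_le_one)
      have "?a \<otimes> x \<in> Z"
      proof (rule Z_closed)
        fix e :: real assume "e > 0"
        then obtain y where y: "y \<in> K" "nrm A (x \<ominus> y) < e"
          using lim by blast
        have yc: "y \<in> carrier A"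
          using y KD by blast
        have "?a \<otimes> x \<ominus> ?a \<otimes> y = ?a \<otimes> (x \<ominus> y)"
          using a x yc by (simp add: minus_eq r_distr r_minus del: m_closed)
        then have "nrm A (?a \<otimes> x \<ominus> ?a \<otimes> y) \<le> nrm A ?a * nrm A (x \<ominus> y)"
          using a x yc nrm_mult[of ?a "x \<ominus> y"] by simp
        also have "\<dots> \<le> 1 * nrm A (x \<ominus> y)"
          using a x yc by (intro mult_right_mono nrm_nonneg) auto
        finally have "nrm A (?a \<otimes> x \<ominus> ?a \<otimes> y) < e"
          using y by simp
        moreover have "?a \<otimes> y \<in> Z"
          using KD(2)[OF y(1) \<mu>\<nu>] \<mu>\<nu> yc by (simp add: m_assoc)
        ultimately show "\<exists>y\<in>Z. nrm A (?a \<otimes> x \<ominus> y) < e"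
          by blast
      qed (use a x in auto)
      then show "S_word A S \<mu> \<otimes> (star A (S_word A S \<nu>) \<otimes> x) \<in> Z"
        using \<mu>\<nu> x by (simp add: m_assoc)
    qed (rule x)
    fix g x assume g: "g \<in> S ` {1..n}" and x: "x \<in> K"
    then obtain i where i: "i \<in> {1..n}" "g = S i"
      by blast
    have xc: "x \<in> carrier A"
      using x KD by blast
    show "g \<otimes> x \<in> K"
      unfolding K_def
    proof (intro CollectI conjI allI impI)
      fix \<mu> \<nu> assume \<mu>\<nu>: "set \<mu> \<subseteq> {1..n}" "set \<nu> \<subseteq> {1..n}"
      have eq: "star A (S_word A S \<nu>) \<otimes> (g \<otimes> x) = (star A (S_word A S \<nu>) \<otimes> S i) \<otimes> x"
        using i \<mu>\<nu> xc by (simp add: m_assoc)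
      show "S_word A S \<mu> \<otimes> (star A (S_word A S \<nu>) \<otimes> (g \<otimes> x)) \<in> Z"
      \<comment> \<open>With empty \<open>\<nu>\<close> the generator is absorbed into
        \<open>\<mu>\<close>; otherwise it cancels the first letter of \<open>\<nu>\<close> or
        annihilates the term.\<close>
      proof (cases \<nu>)
        case Nil
        have "S_word A S (\<mu> @ [i]) \<otimes> (star A (S_word A S []) \<otimes> x) \<in> Z"
          using \<mu>\<nu> i by (intro KD(2)[OF x]) auto
        moreover have "S_word A S (\<mu> @ [i]) = S_word A S \<mu> \<otimes> S i"
          using \<mu>\<nu> i S_word_append[of S \<mu> "[i]"] by simp
        ultimately show ?thesis
          using Nil i \<mu>\<nu> xc by (simp add: m_assoc)
      next
        case (Cons j \<nu>')
        then show ?thesis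
          unfolding eq star_S_word_mult_S[OF \<mu>\<nu>(2) i(1)]
          using KD(2)[OF x, of \<mu> \<nu>'] \<mu>\<nu> xc Z_zero by auto
      qed
    qed (use i xc in auto)
    show "star A g \<otimes> x \<in> K"
      unfolding K_def
    proof (intro CollectI conjI allI impI)
      fix \<mu> \<nu> assume \<mu>\<nu>: "set \<mu> \<subseteq> {1..n}" "set \<nu> \<subseteq> {1..n}"
      have "star A (S_word A S \<nu>) \<otimes> (star A g \<otimes> x) = star A (S_word A S (i # \<nu>)) \<otimes> x"
        using i \<mu>\<nu> xc by (simp add: star_mult m_assoc)
      then show "S_word A S \<mu> \<otimes> (star A (S_word A S \<nu>) \<otimes> (star A g \<otimes> x)) \<in> Z"
        using KD(2)[OF x, of \<mu> "i # \<nu>"] \<mu>\<nu> i by simp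
    qed (use i xc in auto)
  qed
  then have "w \<in> K"
    using w by simp
  then have "w \<in> Z"
    using KD(2)[of w "[]" "[]"] w(1) by simp
  then have "(\<lambda>M. nrm A w) \<longlonglongrightarrow> 0"
    using w(2) by (simp add: Z_def N_def[abs_def])
  then show ?thesis
    using w(1) by (simp add: LIMSEQ_const_iff nrm_eq_0_iff)
qed

end

section \<open>Intertwiners\<close>

context cuntz_algebra
begin

definition band_unitary :: "(nat \<Rightarrow> nat \<Rightarrow> nat) \<Rightarrow> (nat \<Rightarrow> nat) \<Rightarrow> 'a" where
  "band_unitary m \<theta> = perm_unitary A n S 2 (band_perm n m \<theta>)"

definition band_aut :: "(nat \<Rightarrow> nat \<Rightarrow> nat) \<Rightarrow> (nat \<Rightarrow> nat) \<Rightarrow> 'a \<Rightarrow> 'a" where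
  "band_aut m \<theta> = lam A n S (band_unitary m \<theta>)"

context
  fixes m :: "nat \<Rightarrow> nat \<Rightarrow> nat" and \<theta> :: "nat \<Rightarrow> nat"
  assumes band: "rect_band n m" and \<theta>: "\<theta> permutes {1..n}"
begin

lemma band_unitary_unitary: "band_unitary m \<theta> \<in> unitaries A"
  unfolding band_unitary_def using band_perm_permutes[OF band \<theta>] by (rule perm_unitary_unitary)

lemma band_unitary_closed: "band_unitary m \<theta> \<in> carrier A"
  using band_unitary_unitary by (simp add: unitaries_def)

lemma band_unitary_gen_closed: "i \<in> {1..n} \<Longrightarrow> band_unitary m \<theta> \<otimes> S i \<in> carrier A"
  using band_unitary_closed S_closed by blast

lemma band_unitary_gen_isometry:
  assumes i: "i \<in> {1..n}"
  shows "star A (band_unitary m \<theta> \<otimes> S i) \<otimes> (band_unitary m \<theta> \<otimes> S i) = \<one>"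
proof -
  note c = S_closed[OF i] band_unitary_closed
  have "star A (band_unitary m \<theta> \<otimes> S i) \<otimes> (band_unitary m \<theta> \<otimes> S i)
      = star A (S i) \<otimes> ((star A (band_unitary m \<theta>) \<otimes> band_unitary m \<theta>) \<otimes> S i)"
    using c by (simp only: star_mult m_assoc m_closed star_closed)
  then show ?thesis
    using band_unitary_unitary S_isometry[OF i i] c by (simp add: unitaries_def)
qed

lemma band_unitary_mult:
  assumes ij: "i \<in> {1..n}" "j \<in> {1..n}" and x: "x \<in> carrier A"
  shows "band_unitary m \<theta> \<otimes> (S i \<otimes> (S j \<otimes> x)) = S (m (\<theta> (m i j)) i) \<otimes> (S (m j (\<theta> (m i j))) \<otimes> x)"
proof -
  define z where "z = \<theta> (m i j)"
  have z: "m z i \<in> {1..n}" "m j z \<in> {1..n}"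
    using ij band_closed[OF band] permutes_letter[OF band \<theta>] unfolding z_def by blast+
  have w: "[i, j] \<in> words n 2"
    using ij words_2 by blast
  have "band_unitary m \<theta> \<otimes> S_word A S [i, j] = S_word A S [m z i, m j z]"
    unfolding band_unitary_def perm_unitary_mult_word[OF band_perm_permutes[OF band \<theta>] w]
      band_perm_word[OF band ij] z_def ..
  then have "band_unitary m \<theta> \<otimes> (S i \<otimes> S j) = S (m z i) \<otimes> S (m j z)"
    using S_closed[OF ij(1)] S_closed[OF ij(2)] S_closed[OF z(1)] S_closed[OF z(2)] by simp
  then have "band_unitary m \<theta> \<otimes> (S i \<otimes> S j) \<otimes> x = S (m z i) \<otimes> S (m j z) \<otimes> x"
    by simp
  then show ?thesis
    using S_closed[OF ij(1)] S_closed[OF ij(2)] S_closed[OF z(1)] S_closed[OF z(2)] x band_unitary_closed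
    by (simp add: m_assoc z_def)
qed

lemma band_unitary_mult':
  assumes ij: "i \<in> {1..n}" "j \<in> {1..n}"
  shows "band_unitary m \<theta> \<otimes> (S i \<otimes> S j) = S (m (\<theta> (m i j)) i) \<otimes> S (m j (\<theta> (m i j)))"
proof -
  define z where "z = \<theta> (m i j)"
  have z: "m z i \<in> {1..n}" "m j z \<in> {1..n}"
    using ij band_closed[OF band] permutes_letter[OF band \<theta>] unfolding z_def by blast+
  show ?thesis
    using band_unitary_mult[OF ij one_closed] S_closed[OF ij(2)] S_closed[OF z(2)] by (simp add: z_def)
qed

text \<open>The unitary needs two letters to act on, so the product over \<alpha> alone is not a
  monomial in the generators; the extra \<open>S r\<close> completes the last pair. When i is
  prepended, the unitary meets the head h of the coded suffix instead of j, which is harmless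
  because i * h = i * j.\<close>

lemma S_word_band_unitary:
  assumes "set \<alpha> \<subseteq> {1..n}" "r \<in> {1..n}"
  shows "S_word A (\<lambda>i. band_unitary m \<theta> \<otimes> S i) \<alpha> \<otimes> S r = S_word A S (band_code m \<theta> (\<alpha> @ [r]))"
  using assms(1)
proof (induction \<alpha>)
  case Nil
  then show ?case using assms(2) by simp
next
  case (Cons i \<alpha>)
  obtain j \<beta> where \<beta>: "\<alpha> @ [r] = j # \<beta>"
    by (cases "\<alpha> @ [r]") auto
  have sub: "set (j # \<beta>) \<subseteq> {1..n}"
    using Cons.prems assms(2) unfolding \<beta>[symmetric] by auto
  have i: "i \<in> {1..n}" and \<alpha>: "set \<alpha> \<subseteq> {1..n}" and j: "j \<in> {1..n}"
    using Cons.prems sub by auto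
  define h where "h = hd (band_code m \<theta> (j # \<beta>))"
  define t where "t = tl (band_code m \<theta> (j # \<beta>))"
  have code: "band_code m \<theta> (j # \<beta>) = h # t"
    unfolding h_def t_def by (rule band_code_Cons_hd_tl)
  have h: "h \<in> {1..n}" "m i h = m i j"
    using hd_band_code[OF band \<theta> sub] i unfolding h_def by blast+
  have t: "set t \<subseteq> {1..n}"
    using set_band_code[OF band \<theta> sub] unfolding code by simp
  have V: "(\<lambda>i. band_unitary m \<theta> \<otimes> S i) \<in> {1..n} \<rightarrow> carrier A"
    using band_unitary_gen_closed by blast
  have "S_word A (\<lambda>i. band_unitary m \<theta> \<otimes> S i) (i # \<alpha>) \<otimes> S r
      = band_unitary m \<theta> \<otimes> S i \<otimes> (S_word A (\<lambda>i. band_unitary m \<theta> \<otimes> S i) \<alpha> \<otimes> S r)"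
    using S_word_closed[OF V \<alpha>] band_unitary_closed S_closed[OF i] S_closed[OF assms(2)]
    by (simp add: m_assoc)
  also have "\<dots> = band_unitary m \<theta> \<otimes> (S i \<otimes> (S h \<otimes> S_word A S t))"
    using Cons.IH[OF \<alpha>] band_unitary_closed S_closed[OF i] S_closed[OF h(1)] S_word_S_closed[OF t]
    unfolding \<beta> code by (simp add: m_assoc)
  also have "\<dots> = S (m (\<theta> (m i j)) i) \<otimes> (S (m h (\<theta> (m i j))) \<otimes> S_word A S t)"
    using band_unitary_mult[OF i h(1) S_word_S_closed[OF t]] h(2) by simp
  also have "\<dots> = S_word A S (band_code m \<theta> (i # j # \<beta>))"
    by (simp add: Let_def h_def t_def)
  finally show ?case
    using \<beta> by simp
qed

lemma nrm_S_word_band_le: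
  assumes "set \<alpha> \<subseteq> {1..n}"
  shows "nrm A (S_word A (\<lambda>i. band_unitary m \<theta> \<otimes> S i) \<alpha>) \<le> 1"
  using assms
proof (induction \<alpha>)
  case Nil
  then show ?case using nrm_one_le by simp
next
  case (Cons i \<alpha>)
  then have i: "i \<in> {1..n}" and \<alpha>: "set \<alpha> \<subseteq> {1..n}"
    by auto
  have V: "(\<lambda>i. band_unitary m \<theta> \<otimes> S i) \<in> {1..n} \<rightarrow> carrier A"
    using band_unitary_gen_closed by blast
  show ?case
    unfolding S_word_Cons
    apply (rule nrm_mult_le_one)
    using nrm_isometry_le[OF band_unitary_gen_closed[OF i] band_unitary_gen_isometry[OF i]]
      Cons.IH[OF \<alpha>] S_word_closed[OF V \<alpha>] band_unitary_gen_closed[OF i]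
    by blast+
qed

lemma band_aut_hom: "band_aut m \<theta> \<in> cstar_hom A A"
  unfolding band_aut_def band_unitary_def by (rule lam_perm[OF band_perm_permutes[OF band \<theta>]])

lemma band_aut_gen: "i \<in> {1..n} \<Longrightarrow> band_aut m \<theta> (S i) = band_unitary m \<theta> \<otimes> S i"
  unfolding band_aut_def band_unitary_def by (rule lam_perm[OF band_perm_permutes[OF band \<theta>]])

end

text \<open>Supplies on both sides the extra letter that \<open>S_word_band_unitary\<close> asks
  for: star (S r) in front of the adjoint of one product, and \<open>S s\<close> behind the
  other.\<close>

lemma eq_zero_by_entries:
  assumes x: "x \<in> carrier A"
    and eq: "\<And>r s. \<lbrakk>r \<in> {1..n}; s \<in> {1..n}\<rbrakk> \<Longrightarrow> star A (S r) \<otimes> x \<otimes> S s = \<zero>"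
  shows "x = \<zero>"
proof -
  have *: "star A x \<otimes> S r = \<zero> \<otimes> S r" if r: "r \<in> {1..n}" for r
  proof -
    have "star A (S r) \<otimes> x = \<zero>"
      by (rule eq_by_generators) (use x r eq in auto)
    then have "star A (star A (S r) \<otimes> x) = \<zero>"
      by simp
    then show ?thesis
      using x r by (simp add: star_mult)
  qed
  have "star A x = \<zero>"
    by (rule eq_by_generators) (use x * in auto)
  then show ?thesis
    using star_star[OF x] by simp
qed

context
  fixes m m' :: "nat \<Rightarrow> nat \<Rightarrow> nat" and \<theta> \<tau> :: "nat \<Rightarrow> nat"
  assumes band: "rect_band n m" "rect_band n m'"
    and perm: "\<theta> permutes {1..n}" "\<tau> permutes {1..n}"
begin

text \<open>Entry by entry, the expression is star(S_b) S_mu star(S_nu) S_c, where b and c code the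
  same prefix of a. Here star(S_nu) S_c is 0 or deletes the first |nu| letters of c. What remains
  can survive only if letter |mu| + k of b equals letter |nu| + k of c, which the choice of k
  forbids.\<close>

lemma band_entries_vanish:
  assumes a: "range a \<subseteq> {1..n}" and sep: "no_common_tail (block_code m \<theta> a) (block_code m' \<tau> a)"
    and \<mu>: "set \<mu> \<subseteq> {1..n}" and \<nu>: "set \<nu> \<subseteq> {1..n}"
  shows "\<forall>\<^sub>F L in sequentially.
    star A (S_word A (\<lambda>i. band_unitary m \<theta> \<otimes> S i) (map a [0..<L])) \<otimes>
      (S_word A S \<mu> \<otimes> star A (S_word A S \<nu>)) \<otimes>
      S_word A (\<lambda>i. band_unitary m' \<tau> \<otimes> S i) (map a [0..<L]) = \<zero>"
proof -
  \<comment> \<open>Asking for k >= 1 keeps both positions off the initial letter even when \<mu> or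
    \<nu> is empty.\<close>
  obtain k where k: "k \<ge> 1" "block_code m \<theta> a (length \<mu> + k) \<noteq> block_code m' \<tau> a (length \<nu> + k)"
    using sep unfolding no_common_tail_def by blast
  have V: "(\<lambda>i. band_unitary m \<theta> \<otimes> S i) \<in> {1..n} \<rightarrow> carrier A"
    using band_unitary_gen_closed[OF band(1) perm(1)] by blast
  have V': "(\<lambda>i. band_unitary m' \<tau> \<otimes> S i) \<in> {1..n} \<rightarrow> carrier A"
    using band_unitary_gen_closed[OF band(2) perm(2)] by blast
  \<comment> \<open>The bound \<open>q + 1 < L\<close> keeps the window of three letters inside the
    prefix of \<open>a\<close>, so the appended letter r is never read.\<close>
  have code_nth: "band_code b \<rho> (map a [0..<L] @ [r]) ! q = block_code b \<rho> a q"
    if "rect_band n b" "\<rho> permutes {1..n}" "r \<in> {1..n}" "0 < q" "q + 1 < L" for b \<rho> r q L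
  proof -
    have "set (map a [0..<L] @ [r]) \<subseteq> {1..n}"
      using a that(3) by auto
    moreover have "q - 1 < L" "q < L"
      using that(5) by simp_all
    ultimately show ?thesis
      using band_code_nth[OF that(1,2) _ that(4), of "map a [0..<L] @ [r]"] that(5)
      by (simp add: block_code_def nth_append)
  qed
  show ?thesis
    unfolding eventually_sequentially
  proof (intro exI allI impI)
    fix L assume L: "L \<ge> length \<mu> + length \<nu> + k + 2"
    let ?\<alpha> = "map a [0..<L]"
    let ?P = "S_word A (\<lambda>i. band_unitary m \<theta> \<otimes> S i) ?\<alpha>"
    let ?Q = "S_word A (\<lambda>i. band_unitary m' \<tau> \<otimes> S i) ?\<alpha>"
    let ?M = "S_word A S \<mu>" and ?N = "S_word A S \<nu>"
    have \<alpha>: "set ?\<alpha> \<subseteq> {1..n}"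
      using a by auto
    have PQ: "?P \<in> carrier A" "?Q \<in> carrier A"
      using S_word_closed[OF V \<alpha>] S_word_closed[OF V' \<alpha>] .
    have MN: "?M \<in> carrier A" "?N \<in> carrier A"
      using \<mu> \<nu> by auto
    show "star A ?P \<otimes> (?M \<otimes> star A ?N) \<otimes> ?Q = \<zero>"
    proof (rule eq_zero_by_entries)
      fix r s assume rs: "r \<in> {1..n}" "s \<in> {1..n}"
      define b where "b = band_code m \<theta> (?\<alpha> @ [r])"
      define c where "c = band_code m' \<tau> (?\<alpha> @ [s])"
      have sub: "set (?\<alpha> @ [r]) \<subseteq> {1..n}" "set (?\<alpha> @ [s]) \<subseteq> {1..n}"
        using \<alpha> rs by auto
      have bc: "set b \<subseteq> {1..n}" "set c \<subseteq> {1..n}" "length b = L + 1" "length c = L + 1"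
        using set_band_code[OF band(1) perm(1) sub(1)] set_band_code[OF band(2) perm(2) sub(2)]
        by (simp_all add: b_def c_def)
      have take_c: "set (take (length \<nu>) c) \<subseteq> {1..n}" and drop_c: "set (drop (length \<nu>) c) \<subseteq> {1..n}"
        using bc(2) set_take_subset[of "length \<nu>" c] set_drop_subset[of "length \<nu>" c] by blast+
      have "star A (S r) \<otimes> (star A ?P \<otimes> (?M \<otimes> star A ?N) \<otimes> ?Q) \<otimes> S s
          = star A (?P \<otimes> S r) \<otimes> (?M \<otimes> (star A ?N \<otimes> (?Q \<otimes> S s)))"
        using PQ MN S_closed[OF rs(1)] S_closed[OF rs(2)] by (simp add: star_mult m_assoc)
      also have "\<dots> = star A (S_word A S b) \<otimes> (?M \<otimes> (star A ?N \<otimes> S_word A S c))"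
        unfolding b_def c_def S_word_band_unitary[OF band(1) perm(1) \<alpha> rs(1)]
          S_word_band_unitary[OF band(2) perm(2) \<alpha> rs(2)] ..
      also have "S_word A S c = S_word A S (take (length \<nu>) c) \<otimes> S_word A S (drop (length \<nu>) c)"
        using S_word_append[of S "take (length \<nu>) c" "drop (length \<nu>) c"] take_c drop_c S_closed by auto
      also have "star A ?N \<otimes> \<dots> = (star A ?N \<otimes> S_word A S (take (length \<nu>) c)) \<otimes> S_word A S (drop (length \<nu>) c)"
        using MN S_word_S_closed[OF take_c] S_word_S_closed[OF drop_c] by (simp add: m_assoc)
      also have "star A ?N \<otimes> S_word A S (take (length \<nu>) c) = (if \<nu> = take (length \<nu>) c then \<one> else \<zero>)"
        using \<nu> take_c bc L by (intro star_word_mult[of _ "length \<nu>"]) (auto simp: words_def)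
      also have "star A (S_word A S b) \<otimes> (?M \<otimes> ((if \<nu> = take (length \<nu>) c then \<one> else \<zero>) \<otimes> S_word A S (drop (length \<nu>) c))) = \<zero>"
      proof (rule ccontr)
        assume ne: "\<not> ?thesis"
        have "\<nu> = take (length \<nu>) c"
        proof (rule ccontr)
          assume "\<nu> \<noteq> take (length \<nu>) c"
          then show False
            using ne MN S_word_S_closed[OF drop_c] S_word_S_closed[OF bc(1)] by simp
        qed
        then have "star A (S_word A S b) \<otimes> (?M \<otimes> S_word A S (drop (length \<nu>) c)) \<noteq> \<zero>"
          using ne S_word_S_closed[OF drop_c] by simp
        then have ne': "star A (S_word A S b) \<otimes> S_word A S (\<mu> @ drop (length \<nu>) c) \<noteq> \<zero>"
          using S_word_append[of S \<mu> "drop (length \<nu>) c"] drop_c \<mu> S_closed by auto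
        have "set (\<mu> @ drop (length \<nu>) c) \<subseteq> {1..n}"
          using \<mu> drop_c by auto
        from star_word_mult_nonzero[OF bc(1) this ne', of "length \<mu> + k"]
        have "b ! (length \<mu> + k) = c ! (length \<nu> + k)"
          using bc L by (simp add: nth_append)
        moreover have "b ! (length \<mu> + k) = block_code m \<theta> a (length \<mu> + k)"
          unfolding b_def using L k(1) by (intro code_nth band perm rs) auto
        moreover have "c ! (length \<nu> + k) = block_code m' \<tau> a (length \<nu> + k)"
          unfolding c_def using L k(1) by (intro code_nth band perm rs) auto
        ultimately show False
          using k(2) by simp
      qed
      finally show "star A (S r) \<otimes> (star A ?P \<otimes> (?M \<otimes> star A ?N) \<otimes> ?Q) \<otimes> S s = \<zero>" .
    qed (use PQ MN in auto)
  qed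
qed

lemma band_intertwiner_eq_zero:
  assumes a: "range a \<subseteq> {1..n}" and sep: "no_common_tail (block_code m \<theta> a) (block_code m' \<tau> a)"
    and w: "w \<in> carrier A"
    and int: "\<And>i. i \<in> {1..n} \<Longrightarrow>
      band_unitary m \<theta> \<otimes> S i \<otimes> w = w \<otimes> (band_unitary m' \<tau> \<otimes> S i)"
  shows "w = \<zero>"
proof -
  let ?V = "\<lambda>i. band_unitary m \<theta> \<otimes> S i" and ?V' = "\<lambda>i. band_unitary m' \<tau> \<otimes> S i"
  note clo = band_unitary_gen_closed[OF band(1) perm(1)] band_unitary_gen_closed[OF band(2) perm(2)]
  have V: "?V \<in> {1..n} \<rightarrow> carrier A" "?V' \<in> {1..n} \<rightarrow> carrier A"
    using clo by blast+
  have \<alpha>: "set (map a [0..<L]) \<subseteq> {1..n}" for L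
    using a by auto
  have iso: "star A (S_word A ?V \<alpha>) \<otimes> S_word A ?V \<alpha> = \<one>" if "set \<alpha> \<subseteq> {1..n}" for \<alpha>
    using that
  proof (induction \<alpha>)
    case (Cons i \<alpha>)
    then have i: "i \<in> {1..n}" and \<alpha>': "set \<alpha> \<subseteq> {1..n}"
      by auto
    note c = clo(1)[OF i] S_word_closed[OF V(1) \<alpha>']
    have "star A (S_word A ?V (i # \<alpha>)) \<otimes> S_word A ?V (i # \<alpha>)
        = star A (S_word A ?V \<alpha>) \<otimes> ((star A (?V i) \<otimes> ?V i) \<otimes> S_word A ?V \<alpha>)"
      using c by (simp only: S_word_Cons star_mult m_assoc m_closed star_closed)
    also have "\<dots> = \<one>"
      unfolding band_unitary_gen_isometry[OF band(1) perm(1) i] using Cons.IH[OF \<alpha>'] c by simp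
    finally show ?case .
  qed simp
  have comm: "S_word A ?V \<alpha> \<otimes> w = w \<otimes> S_word A ?V' \<alpha>" if "set \<alpha> \<subseteq> {1..n}" for \<alpha>
    using that
  proof (induction \<alpha>)
    case (Cons i \<alpha>)
    then have i: "i \<in> {1..n}" and \<alpha>': "set \<alpha> \<subseteq> {1..n}"
      by auto
    note c = clo[OF i] S_word_closed[OF V(1) \<alpha>'] S_word_closed[OF V(2) \<alpha>'] w
    have "S_word A ?V (i # \<alpha>) \<otimes> w = ?V i \<otimes> (S_word A ?V \<alpha> \<otimes> w)"
      using c by (simp only: S_word_Cons m_assoc)
    also have "\<dots> = (?V i \<otimes> w) \<otimes> S_word A ?V' \<alpha>"
      unfolding Cons.IH[OF \<alpha>'] using c by (simp only: m_assoc)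
    also have "\<dots> = w \<otimes> S_word A ?V' (i # \<alpha>)"
      unfolding int[OF i] S_word_Cons using c by (simp only: m_assoc)
    finally show ?case .
  qed (use w in simp)
  show ?thesis
  proof (rule intertwiner_eq_zero[where p = "\<lambda>L. S_word A ?V (map a [0..<L])" and q = "\<lambda>L. S_word A ?V' (map a [0..<L])"])
    show "S_word A ?V (map a [0..<L]) \<in> carrier A" "S_word A ?V' (map a [0..<L]) \<in> carrier A" for L
      using S_word_closed[OF V(1) \<alpha>] S_word_closed[OF V(2) \<alpha>] .
    show "nrm A (S_word A ?V (map a [0..<L])) \<le> 1" "nrm A (S_word A ?V' (map a [0..<L])) \<le> 1" for L
      using nrm_S_word_band_le[OF band(1) perm(1) \<alpha>] nrm_S_word_band_le[OF band(2) perm(2) \<alpha>] .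
    show "w \<in> carrier A" by (rule w)
    show "star A (S_word A ?V (map a [0..<L])) \<otimes> w \<otimes> S_word A ?V' (map a [0..<L]) = w" for L
    proof -
      let ?P = "S_word A ?V (map a [0..<L])" and ?Q = "S_word A ?V' (map a [0..<L])"
      have PQ: "?P \<in> carrier A" "?Q \<in> carrier A"
        using S_word_closed[OF V(1) \<alpha>] S_word_closed[OF V(2) \<alpha>] .
      have "star A ?P \<otimes> w \<otimes> ?Q = star A ?P \<otimes> (w \<otimes> ?Q)"
        using PQ w by (simp only: m_assoc star_closed)
      also have "\<dots> = (star A ?P \<otimes> ?P) \<otimes> w"
        unfolding comm[OF \<alpha>, symmetric] using PQ w by (simp only: m_assoc star_closed)
      finally show ?thesis
        using iso[OF \<alpha>] w by simp
    qed
  qed (rule band_entries_vanish[OF a sep])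
qed

end

end

section \<open>The homomorphism into the outer automorphism group\<close>

lemma no_common_tail_sym: "no_common_tail b c \<Longrightarrow> no_common_tail c b"
  unfolding no_common_tail_def by metis

text \<open>The value \<open>b l\<close> recurs with period P, hence beyond every shift and bound,
  whereas c never takes it from position 1 on.\<close>

lemma no_common_tail_periodic:
  assumes per: "\<And>k. k \<ge> 1 \<Longrightarrow> b (k + P) = b k" and P: "P > 0"
    and l: "l \<ge> 1" and c: "\<And>k. k \<ge> 1 \<Longrightarrow> c k \<noteq> b l"
  shows "no_common_tail b c"
  unfolding no_common_tail_def
proof (intro allI)
  fix p q K :: nat
  have b: "b (l + N * P) = b l" for N
  proof (induction N)
    case (Suc N)
    then show ?case
      using per[of "l + N * P"] l by (simp add: ac_simps)
  qed simp
  \<comment> \<open>The extra 1 makes the index of c at least 1, whatever q is.\<close>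
  define N where "N = p + K + 1"
  have "N \<le> N * P"
    using P by simp
  then have le: "p + K + 1 \<le> l + N * P"
    by (simp add: N_def)
  have "b (p + (l + N * P - p)) = b l"
    using b[of N] le by simp
  moreover have "c (q + (l + N * P - p)) \<noteq> b l"
    using le by (intro c) simp
  ultimately have "b (p + (l + N * P - p)) \<noteq> c (q + (l + N * P - p))"
    by simp
  then show "\<exists>k\<ge>K. b (p + k) \<noteq> c (q + k)"
    using le by (intro exI[of _ "l + N * P - p"]) simp
qed

text \<open>These are the letters at positions 1, 2, 3 in the code of the sequence x y z x y z ...,
  and by periodicity all letters from position 1 on.\<close>

definition orbit_letters :: "(nat \<Rightarrow> nat \<Rightarrow> nat) \<Rightarrow> (nat \<Rightarrow> nat) \<Rightarrow> nat \<Rightarrow> nat \<Rightarrow> nat \<Rightarrow> nat set" where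
  "orbit_letters m s x y z =
     {m (s (m y z)) (s (m x y)), m (s (m z x)) (s (m y z)), m (s (m x y)) (s (m z x))}"

text \<open>The exception k = 0 arises because \<open>block_code\<close> there reads
  \<open>a 0\<close> twice, instead of the letter z that precedes x in the periodic pattern.\<close>

lemma orbit_letters_eq_block_code:
  assumes a: "a = (\<lambda>k. [x, y, z] ! (k mod 3))"
  shows "orbit_letters m s x y z = block_code m s a ` {1..}"
    and "block_code m s a (k + 3) = block_code m s a k \<or> k = 0"
proof -
  have per: "block_code m s a (k + 3) = block_code m s a k" if k: "k \<ge> 1" for k
  proof -
    have a3: "a (i + 3) = a i" for i
      by (simp add: a)
    have "k + 3 - 1 = (k - 1) + 3" "k + 3 + 1 = (k + 1) + 3"
      using k by simp_all
    then show ?thesis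
      unfolding block_code_def by (simp only: a3)
  qed
  then show "block_code m s a (k + 3) = block_code m s a k \<or> k = 0"
    by auto
  have b: "block_code m s a 1 = m (s (m y z)) (s (m x y))" "block_code m s a 2 = m (s (m z x)) (s (m y z))"
    "block_code m s a 3 = m (s (m x y)) (s (m z x))"
    by (simp_all add: block_code_def a)
  have "block_code m s a k \<in> {block_code m s a 1, block_code m s a 2, block_code m s a 3}" if "k \<ge> 1" for k
    using that
  proof (induction k rule: less_induct)
    case (less k)
    show ?case
    proof (cases "k \<le> 3")
      case True
      then have "k = 1 \<or> k = 2 \<or> k = 3"
        using less.prems by auto
      then show ?thesis by auto
    next
      case False
      then show ?thesis
        using less.IH[of "k - 3"] per[of "k - 3"] by simp
    qed
  qed
  then have "block_code m s a ` {1..} = {block_code m s a 1, block_code m s a 2, block_code m s a 3}"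
    by (auto simp del: One_nat_def)
  then show "orbit_letters m s x y z = block_code m s a ` {1..}"
    by (simp only: orbit_letters_def b)
qed

text \<open>Equal cosets put f into the coset of g, so f is g followed by conjugation with a unitary
  w; multiplying by w on the right removes the adjoint.\<close>

lemma (in cstar_algebra) out_proj_eq_intertwiner:
  assumes g: "g \<in> carrier (Aut A)" and f: "f \<in> carrier (Aut A)"
    and eq: "out_proj A f = out_proj A g"
  obtains w where "w \<in> unitaries A" "\<And>x. x \<in> carrier A \<Longrightarrow> f x \<otimes> w = w \<otimes> g x"
proof -
  have "f \<in> Inn A #>\<^bsub>Aut A\<^esub> g"
    using out_proj_self[OF f] eq by (simp add: out_proj_def)
  then obtain h where h: "h \<in> Inn A" "f = h \<otimes>\<^bsub>Aut A\<^esub> g"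
    by (auto simp: r_coset_def)
  then obtain w where w: "w \<in> unitaries A" "h = (\<lambda>x\<in>carrier A. w \<otimes> x \<otimes> star A w)"
    by (auto simp: Inn_def)
  have wc: "w \<in> carrier A" "star A w \<otimes> w = \<one>"
    using w by (auto simp: unitaries_def)
  have "f x \<otimes> w = w \<otimes> g x" if x: "x \<in> carrier A" for x
  proof -
    have gx: "g x \<in> carrier A"
      using g x cstar_homD(1) by (auto simp: carrier_Aut)
    have "f x = w \<otimes> g x \<otimes> star A w"
      using h(2) w(2) x gx mult_Aut[of h g] h(1) g Inn_subset_Aut by (auto simp: compose_eq)
    then have "f x \<otimes> w = w \<otimes> (g x \<otimes> (star A w \<otimes> w))"
      using gx wc(1) by (simp only: m_assoc m_closed star_closed)
    then show ?thesis
      using gx wc by simp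
  qed
  then show thesis
    using that w(1) by blast
qed

section \<open>The homomorphism from the symmetric group\<close>

context cuntz_algebra
begin

text \<open>With U, V, W the unitaries of \<theta>, \<tau> and their composite, the left side sends
  S_i to lambda_U(V) U S_i. By uniqueness it remains to identify this with W S_i.\<close>

lemma band_aut_compose:
  assumes band: "rect_band n m" and \<theta>: "\<theta> permutes {1..n}" and \<tau>: "\<tau> permutes {1..n}"
  shows "compose (carrier A) (band_aut m \<theta>) (band_aut m \<tau>) = band_aut m (\<theta> \<circ> \<tau>)"
proof -
  have \<theta>\<tau>: "\<theta> \<circ> \<tau> permutes {1..n}"
    using \<tau> \<theta> by (rule permutes_compose)
  let ?f = "band_aut m \<theta>" and ?U = "band_unitary m \<theta>" and ?V = "band_unitary m \<tau>"
    and ?W = "band_unitary m (\<theta> \<circ> \<tau>)"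
  note f = cstar_homD[OF band_aut_hom[OF band \<theta>]]
  note U = band_unitary_closed[OF band \<theta>] and V = band_unitary_closed[OF band \<tau>]
    and W = band_unitary_closed[OF band \<theta>\<tau>]
  note bc = band_closed[OF band] and letter = permutes_letter[OF band]
  have fV: "?f ?V \<in> carrier A"
    using f(1)[OF V] .
  have key: "?f ?V \<otimes> (?U \<otimes> S i) = ?W \<otimes> S i" if i: "i \<in> {1..n}" for i
  proof (rule eq_by_words[where t = 2])
    show "?f ?V \<otimes> (?U \<otimes> S i) \<in> carrier A" "?W \<otimes> S i \<in> carrier A"
      using fV U W S_closed[OF i] by auto
    fix \<beta> assume "\<beta> \<in> words n 2"
    \<comment> \<open>Writing the test word as an image under the pair permutation of \<theta> gives
      S_beta = U S_j S_r, so that U S_i U S_j = lambda_U(S_i S_j) appears and V can be evaluated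
      inside lambda_U.\<close>
    then obtain \<gamma> where \<gamma>: "\<gamma> \<in> words n 2" "\<beta> = band_perm n m \<theta> \<gamma>"
      using permutes_image[OF band_perm_permutes[OF band \<theta>]] by blast
    then obtain j r where jr: "j \<in> {1..n}" "r \<in> {1..n}" "\<gamma> = [j, r]"
      using words_2 by blast
    define t where "t = \<tau> (m i j)"
    define y where "y = \<theta> (m j r)"
    have t: "t \<in> {1..n}" and st: "\<theta> t \<in> {1..n}" and y: "y \<in> {1..n}"
      using i jr bc letter[OF \<theta>] letter[OF \<tau>] unfolding t_def y_def by blast+
    define p where "p = m t i"
    define q where "q = m j t"
    have pq: "p \<in> {1..n}" "q \<in> {1..n}"
      using i jr t bc unfolding p_def q_def by blast+
    have yq: "m y q \<in> {1..n}" "m r y \<in> {1..n}" "m y j \<in> {1..n}"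
      using jr y pq bc by blast+
    \<comment> \<open>The band laws say that the overlapping steps do not interfere: rewriting q, r
      leaves the product t seen at p unchanged, and replacing j by y * j leaves i * j
      unchanged.\<close>
    have red: "m q r = m j r" "m p (m y q) = t" "m (m y q) (\<theta> t) = m y (\<theta> t)"
      "m (\<theta> t) p = m (\<theta> t) i" "m i (m y j) = m i j" "m (m y j) (\<theta> t) = m y (\<theta> t)"
      unfolding p_def q_def
      by (simp_all only: band_left[OF band] band_right[OF band] band_idem[OF band]
        band_closed[OF band] i jr t y st)
    note c = S_closed[OF i] S_closed[OF jr(1)] S_closed[OF jr(2)] S_closed[OF pq(1)] S_closed[OF pq(2)]
      S_closed[OF yq(1)] S_closed[OF yq(2)] S_closed[OF yq(3)] U V W fV
    have \<beta>: "S_word A S \<beta> = S (m y j) \<otimes> S (m r y)"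
      unfolding \<gamma>(2) jr(3) band_perm_word[OF band jr(1,2)] y_def[symmetric] using c by simp
    have \<beta>': "S_word A S \<beta> = ?U \<otimes> (S j \<otimes> S r)"
      unfolding \<beta> band_unitary_mult'[OF band \<theta> jr(1,2)] y_def ..
    have "?f ?V \<otimes> (?U \<otimes> S i) \<otimes> S_word A S \<beta> = ?f ?V \<otimes> ((?U \<otimes> S i) \<otimes> (?U \<otimes> S j)) \<otimes> S r"
      unfolding \<beta>' using c by (simp only: m_assoc m_closed)
    also have "?f ?V \<otimes> ((?U \<otimes> S i) \<otimes> (?U \<otimes> S j)) = ?f (?V \<otimes> (S i \<otimes> S j))"
      using c f(2) band_aut_gen[OF band \<theta> i] band_aut_gen[OF band \<theta> jr(1)] by simp
    also have "?V \<otimes> (S i \<otimes> S j) = S p \<otimes> S q"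
      unfolding band_unitary_mult'[OF band \<tau> i jr(1)] p_def q_def t_def ..
    also have "?f (S p \<otimes> S q) \<otimes> S r = (?U \<otimes> S p) \<otimes> (?U \<otimes> (S q \<otimes> S r))"
      using c f(2) band_aut_gen[OF band \<theta> pq(1)] band_aut_gen[OF band \<theta> pq(2)]
      by (simp only: m_assoc m_closed)
    also have "?U \<otimes> (S q \<otimes> S r) = S (m y q) \<otimes> S (m r y)"
      unfolding band_unitary_mult'[OF band \<theta> pq(2) jr(2)] red(1) y_def ..
    also have "(?U \<otimes> S p) \<otimes> (S (m y q) \<otimes> S (m r y)) = ?U \<otimes> (S p \<otimes> (S (m y q) \<otimes> S (m r y)))"
      using c by (simp only: m_assoc m_closed)
    also have "\<dots> = S (m (\<theta> t) i) \<otimes> (S (m y (\<theta> t)) \<otimes> S (m r y))"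
      unfolding band_unitary_mult[OF band \<theta> pq(1) yq(1) c(7)] red ..
    also have "\<dots> = ?W \<otimes> (S i \<otimes> (S (m y j) \<otimes> S (m r y)))"
      using band_unitary_mult[OF band \<theta>\<tau> i yq(3) c(7)]
      by (simp only: red o_apply t_def[symmetric])
    also have "\<dots> = ?W \<otimes> S i \<otimes> S_word A S \<beta>"
      unfolding \<beta> using c by (simp only: m_assoc m_closed)
    finally show "?f ?V \<otimes> (?U \<otimes> S i) \<otimes> S_word A S \<beta> = ?W \<otimes> S i \<otimes> S_word A S \<beta>" .
  qed
  show ?thesis
  proof (rule cstar_hom_eqI)
    show "compose (carrier A) ?f (band_aut m \<tau>) \<in> cstar_hom A A"
      using band_aut_hom[OF band \<theta>] band_aut_hom[OF band \<tau>] by (rule cstar_hom_compose)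
    show "band_aut m (\<theta> \<circ> \<tau>) \<in> cstar_hom A A"
      using band_aut_hom[OF band \<theta>\<tau>] .
    fix i assume i: "i \<in> {1..n}"
    have "compose (carrier A) ?f (band_aut m \<tau>) (S i) = ?f (?V \<otimes> S i)"
      using S_closed[OF i] band_aut_gen[OF band \<tau> i] by (simp add: compose_eq)
    also have "\<dots> = ?f ?V \<otimes> (?U \<otimes> S i)"
      using f(2)[OF V S_closed[OF i]] band_aut_gen[OF band \<theta> i] by simp
    finally show "compose (carrier A) ?f (band_aut m \<tau>) (S i) = band_aut m (\<theta> \<circ> \<tau>) (S i)"
      using key[OF i] band_aut_gen[OF band \<theta>\<tau> i] by simp
  qed
qed

lemma band_aut_id:
  assumes band: "rect_band n m"
  shows "band_aut m id = (\<lambda>x\<in>carrier A. x)"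
proof (rule cstar_hom_eqI)
  show "band_aut m id \<in> cstar_hom A A"
    using band permutes_id by (rule band_aut_hom)
  show "(\<lambda>x\<in>carrier A. x) \<in> cstar_hom A A"
    by (rule cstar_hom_id)
  have U: "band_unitary m id \<in> carrier A"
    using band permutes_id by (rule band_unitary_closed)
  have "band_unitary m id = \<one>"
  proof (rule eq_by_words[where t = 2])
    fix \<beta> assume \<beta>: "\<beta> \<in> words n 2"
    have "band_unitary m id \<otimes> S_word A S \<beta> = S_word A S \<beta>"
      unfolding band_unitary_def perm_unitary_mult_word[OF band_perm_permutes[OF band permutes_id] \<beta>]
        band_perm_id[OF band \<beta>] ..
    then show "band_unitary m id \<otimes> S_word A S \<beta> = \<one> \<otimes> S_word A S \<beta>"
      using words_S_closed[OF \<beta>] by simp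
  qed (use U in auto)
  then show "band_aut m id (S i) = (\<lambda>x\<in>carrier A. x) (S i)" if "i \<in> {1..n}" for i
    using band_aut_gen[OF band permutes_id that] S_closed[OF that] by simp
qed

text \<open>By the group law, the map of the inverse permutation is a two-sided inverse.\<close>

lemma band_aut_Aut:
  assumes band: "rect_band n m" and \<theta>: "\<theta> permutes {1..n}"
  shows "band_aut m \<theta> \<in> carrier (Aut A)"
proof -
  let ?f = "band_aut m \<theta>" and ?g = "band_aut m (inv_into UNIV \<theta>)"
  have inv: "inv_into UNIV \<theta> permutes {1..n}"
    using \<theta> by (rule permutes_inv)
  note f = cstar_homD[OF band_aut_hom[OF band \<theta>]] and g = cstar_homD[OF band_aut_hom[OF band inv]]
  have "compose (carrier A) ?f ?g = (\<lambda>x\<in>carrier A. x)" "compose (carrier A) ?g ?f = (\<lambda>x\<in>carrier A. x)"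
    unfolding band_aut_compose[OF band \<theta> inv] band_aut_compose[OF band inv \<theta>]
      permutes_inv_o[OF \<theta>] band_aut_id[OF band] by (rule refl)+
  then have "?f (?g x) = x" "?g (?f x) = x" if "x \<in> carrier A" for x
    using that by (metis compose_eq restrict_apply')+
  then have "bij_betw ?f (carrier A) (carrier A)"
    using f(1) g(1) by (intro bij_betw_byWitness[where f' = ?g]) auto
  then show ?thesis
    using band_aut_hom[OF band \<theta>] f(7) by (simp add: carrier_Aut Bij_def)
qed

lemma band_aut_group_hom:
  assumes band: "rect_band n m"
  shows "group_hom (sym_group n) (Aut A) (band_aut m)"
proof -
  have "band_aut m \<in> hom (sym_group n) (Aut A)"
    by (rule homI)
      (simp_all add: sym_group_carrier sym_group_mult band_aut_Aut[OF band] mult_Aut band_aut_compose[OF band])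
  then show ?thesis
    by (intro group_hom.intro group_hom_axioms.intro sym_group_is_group group_Aut)
qed

lemma unitary_nonzero: "w \<in> unitaries A \<Longrightarrow> w \<noteq> \<zero>"
  using nonzero by (auto simp: unitaries_def)

section \<open>Invariants of the class modulo inner automorphisms\<close>

context
  fixes m m' :: "nat \<Rightarrow> nat \<Rightarrow> nat" and \<theta> \<tau> :: "nat \<Rightarrow> nat"
  assumes band: "rect_band n m" "rect_band n m'"
    and perm: "\<theta> permutes {1..n}" "\<tau> permutes {1..n}"
    and out: "out_proj A (band_aut m \<theta>) = out_proj A (band_aut m' \<tau>)"
begin

lemma band_out_not_separated:
  assumes a: "range a \<subseteq> {1..n}"
  shows "\<not> no_common_tail (block_code m \<theta> a) (block_code m' \<tau> a)"
proof
  assume sep: "no_common_tail (block_code m \<theta> a) (block_code m' \<tau> a)"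
  obtain w where w: "w \<in> unitaries A"
    and int: "\<And>x. x \<in> carrier A \<Longrightarrow> band_aut m \<theta> x \<otimes> w = w \<otimes> band_aut m' \<tau> x"
    using out_proj_eq_intertwiner[OF band_aut_Aut[OF band(2) perm(2)] band_aut_Aut[OF band(1) perm(1)] out]
    by blast
  have "w = \<zero>"
  proof (rule band_intertwiner_eq_zero[OF band perm a sep])
    show "w \<in> carrier A"
      using w by (simp add: unitaries_def)
    show "band_unitary m \<theta> \<otimes> S i \<otimes> w = w \<otimes> (band_unitary m' \<tau> \<otimes> S i)" if "i \<in> {1..n}" for i
      using int[OF S_closed[OF that]]
      unfolding band_aut_gen[OF band(1) perm(1) that] band_aut_gen[OF band(2) perm(2) that] .
  qed
  then show False
    using w unitary_nonzero by blast
qed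

lemma band_out_perm_eq: "\<theta> = \<tau>"
proof
  fix i
  show "\<theta> i = \<tau> i"
  proof (cases "i \<in> {1..n}")
    case True
    \<comment> \<open>Since i * i = i, the constant sequence i has a constant code, with value
      \<theta> i, so a common tail forces equality.\<close>
    have "block_code m \<theta> (\<lambda>_. i) k = \<theta> i" for k
      using band_idem[OF band(1)] permutes_letter[OF band(1) perm(1) True] True
      unfolding block_code_def by metis
    moreover have "block_code m' \<tau> (\<lambda>_. i) k = \<tau> i" for k
      using band_idem[OF band(2)] permutes_letter[OF band(2) perm(2) True] True
      unfolding block_code_def by metis
    ultimately show ?thesis
      using band_out_not_separated[of "\<lambda>_. i"] True by (auto simp: no_common_tail_def)
  next
    case False
    then show ?thesis
      using perm by (simp add: permutes_not_in)
  qed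
qed

text \<open>A letter in only one of the two sets would recur in one code and never occur in the
  other, so the codes would have no common tail; this gives each inclusion in turn.\<close>

lemma band_out_orbit_letters:
  assumes xyz: "x \<in> {1..n}" "y \<in> {1..n}" "z \<in> {1..n}"
  shows "orbit_letters m \<theta> x y z = orbit_letters m' \<tau> x y z"
proof -
  define a where "a k = [x, y, z] ! (k mod 3)" for k :: nat
  have a: "a = (\<lambda>k. [x, y, z] ! (k mod 3))"
    by (rule ext) (rule a_def)
  have ran: "range a \<subseteq> {1..n}"
  proof -
    have "a k \<in> set [x, y, z]" for k
      unfolding a_def by (rule nth_mem) simp
    moreover have "set [x, y, z] \<subseteq> {1..n}"
      using xyz by simp
    ultimately show ?thesis
      by blast
  qed
  have per: "block_code b s a (k + 3) = block_code b s a k" if "k \<ge> 1" for b s k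
    using orbit_letters_eq_block_code(2)[OF a, of b s k] that by auto
  note not_sep = band_out_not_separated[OF ran]
  have *: "block_code m \<theta> a k \<in> block_code m' \<tau> a ` {1..}" if k: "k \<ge> 1" for k
  proof (rule ccontr)
    assume "\<not> ?thesis"
    then have "no_common_tail (block_code m \<theta> a) (block_code m' \<tau> a)"
      by (intro no_common_tail_periodic[where P = 3 and l = k] per k) force+
    then show False
      using not_sep by simp
  qed
  have **: "block_code m' \<tau> a k \<in> block_code m \<theta> a ` {1..}" if k: "k \<ge> 1" for k
  proof (rule ccontr)
    assume "\<not> ?thesis"
    then have "no_common_tail (block_code m' \<tau> a) (block_code m \<theta> a)"
      by (intro no_common_tail_periodic[where P = 3 and l = k] per k) force+
    then show False
      using not_sep no_common_tail_sym by blast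
  qed
  show ?thesis
    using * ** unfolding orbit_letters_eq_block_code(1)[OF a] by auto
qed

end

lemma inj_band_aut:
  assumes "rect_band n m"
  shows "inj_on (band_aut m) {\<theta>. \<theta> permutes {1..n}}"
  by (rule inj_onI) (use band_out_perm_eq[OF assms assms] in auto)

end

section \<open>Grids on four letters\<close>

text \<open>The three transpositions are the edges of the path 1 - b - c - a. Conjugation joins
  adjacent edges, which yields first all transpositions that move 1 and then all
  transpositions.\<close>

lemma transpositions_generate_sym_group:
  assumes abc: "{1, a, b, c} = {1..4}"
  shows "generate (sym_group 4) {Transposition.transpose 1 b, Transposition.transpose b c, Transposition.transpose a c} = carrier (sym_group 4)"
proof -
  interpret group "sym_group 4" by (rule sym_group_is_group)
  let ?G = "{Transposition.transpose 1 b, Transposition.transpose b c, Transposition.transpose a c}"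
  let ?H = "generate (sym_group 4) ?G"
  have "{1, a, b, c} \<subseteq> {1..4}"
    using abc by simp
  then have "?G \<subseteq> carrier (sym_group 4)"
    by (auto simp: sym_group_carrier intro!: permutes_swap_id)
  then have H: "subgroup ?H (sym_group 4)"
    by (rule generate_is_subgroup)
  have id: "id \<in> ?H"
    using subgroup.one_closed[OF H] by (simp add: sym_group_one)
  have comp: "f \<circ> g \<in> ?H" if "f \<in> ?H" "g \<in> ?H" for f g
    using subgroup.m_closed[OF H that] by (simp add: sym_group_mult)
  have trans: "Transposition.transpose x z \<in> ?H" if "Transposition.transpose x y \<in> ?H" "Transposition.transpose y z \<in> ?H" for x y z
  proof (cases "x = y \<or> y = z \<or> x = z")
    case False
    then have "Transposition.transpose x z = Transposition.transpose x y \<circ> Transposition.transpose y z \<circ> Transposition.transpose x y"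
      by (auto simp: fun_eq_iff Transposition.transpose_def)
    then show ?thesis
      using comp that by simp
  qed (use that id in auto)
  have sym: "Transposition.transpose y x \<in> ?H" if "Transposition.transpose x y \<in> ?H" for x y :: nat
    using that by (simp add: transpose_commute)
  have gens: "Transposition.transpose 1 b \<in> ?H" "Transposition.transpose b c \<in> ?H" "Transposition.transpose a c \<in> ?H"
    by (auto intro: generate.incl)
  have to1: "Transposition.transpose 1 x \<in> ?H" if "x \<in> {1, a, b, c}" for x
    using that id gens trans[OF gens(1,2)] trans[OF trans[OF gens(1,2)] sym[OF gens(3)]] by auto
  have "p \<in> ?H" if p: "p permutes {1..4}" for p
    using p finite_atLeastAtMost
  proof (induction rule: permutes_induct)
    case (swap x y p)
    then have "Transposition.transpose x y \<in> ?H"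
      using trans[OF sym[OF to1[of x]] to1[of y]] abc by blast
    then show ?case
      using swap comp by blast
  qed (rule id)
  then show ?thesis
    using subgroup.subset[OF H] by (auto simp: sym_group_carrier)
qed

text \<open>\<open>grid a b i j\<close> is $(x_i, y_j)$ for $1 = (0,0)$, $a = (1,0)$, $b = (0,1)$, $c = (1,1)$.\<close>

definition grid :: "nat \<Rightarrow> nat \<Rightarrow> nat \<Rightarrow> nat \<Rightarrow> nat" where
  "grid a b i j =
     (if i \<in> {1, b} then if j \<in> {1, a} then 1 else b else if j \<in> {1, a} then a else third a b)"

abbreviation (input) index_pairs :: "(nat \<times> nat) set" where
  "index_pairs \<equiv> {(a, b). a \<in> {2,3,4} \<and> b \<in> {2,3,4} \<and> a \<noteq> b}"

lemma index_pairs_eq: "index_pairs = {(2,3), (2,4), (3,2), (3,4), (4,2), (4,3)}"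
  by auto

lemma third_values [simp]:
  "third 2 3 = 4" "third 2 4 = 3" "third 3 2 = 4" "third 3 4 = 2" "third 4 2 = 3" "third 4 3 = 2"
proof -
  have "{2,3,4} - {2,3} = {4::nat}" "{2,3,4} - {2,4} = {3::nat}" "{2,3,4} - {3,2} = {4::nat}"
    "{2,3,4} - {3,4} = {2::nat}" "{2,3,4} - {4,2} = {3::nat}" "{2,3,4} - {4,3} = {2::nat}"
    by auto
  then show "third 2 3 = 4" "third 2 4 = 3" "third 3 2 = 4" "third 3 4 = 2" "third 4 2 = 3" "third 4 3 = 2"
    unfolding third_def by (simp_all only: the_elem_eq)
qed

lemma letters_4: "{1..4} = {1, 2, 3, 4 :: nat}"
  by auto

lemma rect_band_grid: "(a, b) \<in> index_pairs \<Longrightarrow> rect_band 4 (grid a b)"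
  unfolding index_pairs_eq rect_band_def letters_4 by (elim insertE emptyE) (simp_all add: grid_def)

text \<open>Checked on all 16 words for each index pair. For instance, the words with i * j = 1 are
  [1,1], [1,a], [b,1], [b,a], and s_1 exchanges each of them with the word of product b that has the
  same j * i.\<close>

lemma s_eq_band_perm:
  assumes "(a, b) \<in> index_pairs" "\<alpha> \<in> words 4 2"
  shows "band_perm 4 (grid a b) (Transposition.transpose 1 b) \<alpha> = s1 a b \<alpha>"
    and "band_perm 4 (grid a b) (Transposition.transpose b (third a b)) \<alpha> = s2 a b \<alpha>"
    and "band_perm 4 (grid a b) (Transposition.transpose a (third a b)) \<alpha> = s3 a b \<alpha>"
proof -
  obtain i j where ij: "i \<in> {1, 2, 3, 4}" "j \<in> {1, 2, 3, 4}" "\<alpha> = [i, j]"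
    using assms(2) unfolding words_2 letters_4 by blast
  have w: "[i, j] \<in> words 4 2"
    using assms(2) ij by simp
  have "(a, b) \<in> {(2,3), (2,4), (3,2), (3,4), (4,2), (4,3)}"
    using assms(1) unfolding index_pairs_eq .
  then show "band_perm 4 (grid a b) (Transposition.transpose 1 b) \<alpha> = s1 a b \<alpha>"
    and "band_perm 4 (grid a b) (Transposition.transpose b (third a b)) \<alpha> = s2 a b \<alpha>"
    and "band_perm 4 (grid a b) (Transposition.transpose a (third a b)) \<alpha> = s3 a b \<alpha>"
    using ij(1,2) w unfolding ij(3)
    by (elim insertE emptyE; simp add: band_perm_def grid_def Transposition.transpose_def s1_def s2_def s3_def sw_def)+
qed

text \<open>The first test isolates (3,4) and (4,3) but gives equal sets for (2,3) and (2,4), and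
  for (3,2) and (4,2). The second test, on the sequence 1 1 2 1 1 2 ..., separates the members of
  these two pairs.\<close>

lemma grid_orbit_letters_differ:
  assumes "(a, b) \<in> index_pairs" "(a', b') \<in> index_pairs" "(a, b) \<noteq> (a', b')"
  shows "orbit_letters (grid a b) (Transposition.transpose 1 2) 1 2 3
      \<noteq> orbit_letters (grid a' b') (Transposition.transpose 1 2) 1 2 3 \<or>
    orbit_letters (grid a b) (Transposition.transpose 1 3) 1 1 2
      \<noteq> orbit_letters (grid a' b') (Transposition.transpose 1 3) 1 1 2"
proof -
  define L where "L a b = (orbit_letters (grid a b) (Transposition.transpose 1 2) 1 2 3,
    orbit_letters (grid a b) (Transposition.transpose 1 3) 1 1 2)" for a b
  have L: "L 2 3 = ({2, 4}, {1, 3, 4})" "L 2 4 = ({2, 4}, {2, 3})" "L 3 2 = ({1, 4}, {1, 3, 4})"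
    "L 3 4 = ({1, 2, 3}, {1, 3, 4})" "L 4 2 = ({1, 4}, {2, 3})" "L 4 3 = ({3, 4}, {1, 3, 4})"
    unfolding L_def
    by (simp_all add: orbit_letters_def grid_def Transposition.transpose_def insert_commute)
  have "a = 2 \<and> b = 3 \<or> a = 2 \<and> b = 4 \<or> a = 3 \<and> b = 2 \<or> a = 3 \<and> b = 4 \<or> a = 4 \<and> b = 2 \<or> a = 4 \<and> b = 3"
    "a' = 2 \<and> b' = 3 \<or> a' = 2 \<and> b' = 4 \<or> a' = 3 \<and> b' = 2 \<or> a' = 3 \<and> b' = 4 \<or> a' = 4 \<and> b' = 2 \<or> a' = 4 \<and> b' = 3"
    using assms(1,2) by auto
  then have "L a b \<noteq> L a' b'"
    using assms(3) by (elim disjE conjE; simp only: L; simp add: set_eq_subset)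
  then show ?thesis
    unfolding L_def by blast
qed

theorem theorem5p11:
  fixes A :: "'a cstar_struct" and S :: "nat \<Rightarrow> 'a"
  assumes "cuntz_algebra A 4 S"
  shows "(\<forall>a\<in>{2,3,4}. \<forall>b\<in>{2,3,4}. a \<noteq> b \<longrightarrow>
            subgroup (T_group A S a b) (Aut A) \<and>
            T_group A S a b \<subseteq> lam_inv A 4 S 2 \<and>
            (Aut A)\<lparr>carrier := T_group A S a b\<rparr> \<cong> sym_group 4 \<and>
            kernel ((Aut A)\<lparr>carrier := T_group A S a b\<rparr>) (Out A) (out_proj A) = {\<one>\<^bsub>Aut A\<^esub>})
       \<and> inj_on (\<lambda>(a, b). out_proj A ` T_group A S a b)
            {(a, b). a \<in> {2,3,4} \<and> b \<in> {2,3,4} \<and> a \<noteq> b}"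
proof -
  interpret cuntz_algebra A 4 S by (rule assms)
  let ?P = "{\<theta>. \<theta> permutes {1..4::nat}}"
  \<comment> \<open>The generators are images of three transpositions under a homomorphism, so the
    group they generate is the image of all of S_4.\<close>
  have T: "T_group A S a b = band_aut (grid a b) ` ?P" if ab: "(a, b) \<in> index_pairs" for a b
  proof -
    interpret group_hom "sym_group 4" "Aut A" "band_aut (grid a b)"
      by (rule band_aut_group_hom[OF rect_band_grid[OF ab]])
    let ?c = "third a b"
    have abc: "{1, a, b, ?c} = {1..4}"
      using ab unfolding index_pairs_eq letters_4 by (elim insertE emptyE) auto
    have lam: "lam A 4 S (perm_unitary A 4 S 2 s) = band_aut (grid a b) (Transposition.transpose x y)"
      if "\<And>\<alpha>. \<alpha> \<in> words 4 2 \<Longrightarrow> band_perm 4 (grid a b) (Transposition.transpose x y) \<alpha> = s \<alpha>"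
        "x \<in> {1, a, b, ?c}" "y \<in> {1, a, b, ?c}" for x y s
    proof -
      have "Transposition.transpose x y permutes {1..4}"
        using that(2,3) abc by (intro permutes_swap_id) auto
      then have "perm_unitary A 4 S 2 (band_perm 4 (grid a b) (Transposition.transpose x y)) = perm_unitary A 4 S 2 s"
        using that(1) band_perm_permutes[OF rect_band_grid[OF ab]] by (intro perm_unitary_cong) auto
      then show ?thesis
        by (simp add: band_aut_def band_unitary_def)
    qed
    have "(\<lambda>s. lam A 4 S (perm_unitary A 4 S 2 s)) ` {s1 a b, s2 a b, s3 a b}
        = band_aut (grid a b) ` {Transposition.transpose 1 b, Transposition.transpose b ?c, Transposition.transpose a ?c}"
      using lam[OF s_eq_band_perm(1)[OF ab]] lam[OF s_eq_band_perm(2)[OF ab]] lam[OF s_eq_band_perm(3)[OF ab]]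
      by simp
    moreover have "{Transposition.transpose 1 b, Transposition.transpose b ?c, Transposition.transpose a ?c} \<subseteq> carrier (sym_group 4)"
      using abc by (auto simp: sym_group_carrier intro!: permutes_swap_id)
    ultimately have "T_group A S a b =
        band_aut (grid a b) ` generate (sym_group 4) {Transposition.transpose 1 b, Transposition.transpose b ?c, Transposition.transpose a ?c}"
      unfolding T_group_def by (simp only: generate_img)
    then show ?thesis
      unfolding transpositions_generate_sym_group[OF abc] by (simp add: sym_group_def)
  qed
  have one: "subgroup (T_group A S a b) (Aut A) \<and>
            T_group A S a b \<subseteq> lam_inv A 4 S 2 \<and>
            (Aut A)\<lparr>carrier := T_group A S a b\<rparr> \<cong> sym_group 4 \<and>
            kernel ((Aut A)\<lparr>carrier := T_group A S a b\<rparr>) (Out A) (out_proj A) = {\<one>\<^bsub>Aut A\<^esub>}"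
    if ab: "(a, b) \<in> index_pairs" for a b
  proof -
    note band = rect_band_grid[OF ab]
    interpret group_hom "sym_group 4" "Aut A" "band_aut (grid a b)"
      by (rule band_aut_group_hom[OF band])
    have carr: "carrier (sym_group 4) = ?P"
      by (simp add: sym_group_def)
    have sub: "subgroup (T_group A S a b) (Aut A)"
      using img_is_subgroup unfolding T[OF ab] carr .
    have "T_group A S a b \<subseteq> lam_inv A 4 S 2"
    proof
      fix f assume "f \<in> T_group A S a b"
      then obtain \<theta> where \<theta>: "\<theta> permutes {1..4}" "f = band_aut (grid a b) \<theta>"
        unfolding T[OF ab] by blast
      then show "f \<in> lam_inv A 4 S 2"
        using band_aut_Aut[OF band \<theta>(1)] band_perm_permutes[OF band \<theta>(1)]
        unfolding lam_inv_def perm_unitaries_def band_aut_def band_unitary_def by blast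
    qed
    moreover have "sym_group 4 \<cong> (Aut A)\<lparr>carrier := T_group A S a b\<rparr>"
    proof -
      have "band_aut (grid a b) \<in> iso (sym_group 4) ((Aut A)\<lparr>carrier := T_group A S a b\<rparr>)"
      proof (rule isoI)
        show "band_aut (grid a b) \<in> hom (sym_group 4) ((Aut A)\<lparr>carrier := T_group A S a b\<rparr>)"
        proof (rule homI)
          show "band_aut (grid a b) \<theta> \<in> carrier ((Aut A)\<lparr>carrier := T_group A S a b\<rparr>)"
            if "\<theta> \<in> carrier (sym_group 4)" for \<theta>
            using that unfolding T[OF ab] carr by simp
        qed simp
        have "bij_betw (band_aut (grid a b)) ?P (band_aut (grid a b) ` ?P)"
          by (rule bij_betw_imageI[OF inj_band_aut[OF band] refl])
        then show "bij_betw (band_aut (grid a b)) (carrier (sym_group 4))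
            (carrier ((Aut A)\<lparr>carrier := T_group A S a b\<rparr>))"
          unfolding T[OF ab] carr by simp
      qed
      then show ?thesis
        by (auto simp: is_iso_def)
    qed
    then have "(Aut A)\<lparr>carrier := T_group A S a b\<rparr> \<cong> sym_group 4"
      by (rule group.iso_sym[OF sym_group_is_group])
    moreover have "kernel ((Aut A)\<lparr>carrier := T_group A S a b\<rparr>) (Out A) (out_proj A) = {\<one>\<^bsub>Aut A\<^esub>}"
    proof -
      have triv: "f = \<one>\<^bsub>Aut A\<^esub>" if f: "f \<in> T_group A S a b" "out_proj A f = \<one>\<^bsub>Out A\<^esub>" for f
      proof -
        obtain \<theta> where \<theta>: "\<theta> permutes {1..4}" "f = band_aut (grid a b) \<theta>"
          using f(1) unfolding T[OF ab] by blast
        have id: "band_aut (grid a b) id = \<one>\<^bsub>Aut A\<^esub>"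
          unfolding band_aut_id[OF band] one_Aut ..
        have "out_proj A (band_aut (grid a b) \<theta>) = out_proj A (band_aut (grid a b) id)"
          using f(2) \<theta>(2) out_proj_one by (simp add: id)
        \<comment> \<open>A trivial class is the class of the map of \<open>id\<close>, so the
          comparison with both grids equal gives \<theta> = id.\<close>
        from band_out_perm_eq[OF band band \<theta>(1) permutes_id this] show ?thesis
          using \<theta>(2) id by simp
      qed
      have "kernel ((Aut A)\<lparr>carrier := T_group A S a b\<rparr>) (Out A) (out_proj A)
          = {f \<in> T_group A S a b. out_proj A f = \<one>\<^bsub>Out A\<^esub>}"
        by (simp add: kernel_def)
      also have "\<dots> = {\<one>\<^bsub>Aut A\<^esub>}"
        using triv subgroup.one_closed[OF sub] out_proj_one by blast
      finally show ?thesis .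
    qed
    ultimately show ?thesis
      using sub by blast
  qed
  have two: "(a, b) = (a', b')"
    if ab: "(a, b) \<in> index_pairs" and ab': "(a', b') \<in> index_pairs"
      and eq: "out_proj A ` T_group A S a b = out_proj A ` T_group A S a' b'" for a b a' b'
  proof -
    note band = rect_band_grid[OF ab] rect_band_grid[OF ab']
    \<comment> \<open>The permutation \<tau> on the other side is unknown at first; once it is
      identified with \<theta>, the letter sets of the two grids can be compared for the same
      permutation.\<close>
    have letters: "orbit_letters (grid a b) \<theta> x y z = orbit_letters (grid a' b') \<theta> x y z"
      if \<theta>: "\<theta> permutes {1..4}" and xyz: "x \<in> {1..4}" "y \<in> {1..4}" "z \<in> {1..4}" for \<theta> x y z
    proof -
      have "out_proj A (band_aut (grid a b) \<theta>) \<in> out_proj A ` T_group A S a' b'"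
        using \<theta> unfolding eq[symmetric] T[OF ab] by blast
      then obtain \<tau> where \<tau>: "\<tau> permutes {1..4}"
        and out: "out_proj A (band_aut (grid a b) \<theta>) = out_proj A (band_aut (grid a' b') \<tau>)"
        unfolding T[OF ab'] by blast
      have "\<theta> = \<tau>"
        by (rule band_out_perm_eq[OF band \<theta> \<tau> out])
      then show ?thesis
        using band_out_orbit_letters[OF band \<theta> \<tau> out xyz] by simp
    qed
    have "Transposition.transpose 1 2 permutes {1..4::nat}" "Transposition.transpose 1 3 permutes {1..4::nat}"
      by (auto intro!: permutes_swap_id)
    then show ?thesis
      using letters[of "Transposition.transpose 1 2" 1 2 3] letters[of "Transposition.transpose 1 3" 1 1 2]
        grid_orbit_letters_differ[OF ab ab'] by auto
  qed
  show ?thesis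
  proof (intro conjI ballI impI inj_onI)
    fix p q assume "p \<in> index_pairs" "q \<in> index_pairs"
      "(case p of (a, b) \<Rightarrow> out_proj A ` T_group A S a b) = (case q of (a, b) \<Rightarrow> out_proj A ` T_group A S a b)"
    then show "p = q"
      using two by (cases p; cases q) (simp only: case_prod_conv)
  qed (use one in auto)
qed

end
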